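(* An equation $\varepsilon$ in the language of $\ell$-pregroups fails in $\mathsf{DLP}$ if and only if it fails in $\mathbf{F}_n(\mathbb{Z})$, where $n=2^{|\varepsilon|}|\varepsilon|^4$.
   Context: $|\varepsilon|$ denotes the length of the equation $\varepsilon$. An $\ell$-pregroup is an algebra $(A,\wedge,\vee,\cdot,{}^{\ell},{}^{r},1)$ with lattice reduct, monoid reduct, order-preserving multiplication, and $x^{\ell}x\le 1\le xx^{\ell}$, $xx^{r}\le 1\le x^{r}x$; $\mathsf{DLP}$ is the variety of distributive $\ell$-pregroups. $\mathbf{F}(\mathbb{Z})$ is the $\ell$-pregroup of all maps on $\mathbb{Z}$ having residuals and dual residuals of all orders (residual $f^r(b)=\max\{a:f(a)\le b\}$, dual residual $f^\ell(a)=\min\{b:a\le f(b)\}$), under composition, identity, pointwise order, ${}^\ell,{}^r$; $\mathbf{F}_n(\mathbb{Z})$ is its subalgebra of elements with $f^{\ell^n}=f^{r^n}$. *)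

theory Defs
  imports "HOL-Algebra.Group"
begin

section \<open>Distributive l-pregroups\<close>

record 'a lpregroup = "'a monoid" +
  lp_meet :: "'a \<Rightarrow> 'a \<Rightarrow> 'a"  (infixl \<open>\<^bold>\<and>\<index>\<close> 70)
  lp_join :: "'a \<Rightarrow> 'a \<Rightarrow> 'a"  (infixl \<open>\<^bold>\<or>\<index>\<close> 65)
  lp_l :: "'a \<Rightarrow> 'a"  (\<open>\<l>\<index> _\<close> [81] 80)
  lp_r :: "'a \<Rightarrow> 'a"  (\<open>\<r>\<index> _\<close> [81] 80)

definition lp_le :: "('a, 'm) lpregroup_scheme \<Rightarrow> 'a \<Rightarrow> 'a \<Rightarrow> bool"  (infix \<open>\<^bold>\<le>\<index>\<close> 50)
  where "x \<^bold>\<le>\<^bsub>A\<^esub> y \<longleftrightarrow> x \<^bold>\<and>\<^bsub>A\<^esub> y = x"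

locale lpregroup = monoid A for A (structure) +
  assumes meet_closed: "\<lbrakk>x \<in> carrier A; y \<in> carrier A\<rbrakk> \<Longrightarrow> x \<^bold>\<and> y \<in> carrier A"
    and join_closed: "\<lbrakk>x \<in> carrier A; y \<in> carrier A\<rbrakk> \<Longrightarrow> x \<^bold>\<or> y \<in> carrier A"
    and l_closed: "x \<in> carrier A \<Longrightarrow> \<l> x \<in> carrier A"
    and r_closed: "x \<in> carrier A \<Longrightarrow> \<r> x \<in> carrier A"
    and meet_commute: "\<lbrakk>x \<in> carrier A; y \<in> carrier A\<rbrakk> \<Longrightarrow> x \<^bold>\<and> y = y \<^bold>\<and> x"
    and join_commute: "\<lbrakk>x \<in> carrier A; y \<in> carrier A\<rbrakk> \<Longrightarrow> x \<^bold>\<or> y = y \<^bold>\<or> x"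
    and meet_assoc: "\<lbrakk>x \<in> carrier A; y \<in> carrier A; z \<in> carrier A\<rbrakk>
      \<Longrightarrow> (x \<^bold>\<and> y) \<^bold>\<and> z = x \<^bold>\<and> (y \<^bold>\<and> z)"
    and join_assoc: "\<lbrakk>x \<in> carrier A; y \<in> carrier A; z \<in> carrier A\<rbrakk>
      \<Longrightarrow> (x \<^bold>\<or> y) \<^bold>\<or> z = x \<^bold>\<or> (y \<^bold>\<or> z)"
    and meet_join_absorb: "\<lbrakk>x \<in> carrier A; y \<in> carrier A\<rbrakk> \<Longrightarrow> x \<^bold>\<and> (x \<^bold>\<or> y) = x"
    and join_meet_absorb: "\<lbrakk>x \<in> carrier A; y \<in> carrier A\<rbrakk> \<Longrightarrow> x \<^bold>\<or> (x \<^bold>\<and> y) = x"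
    and mult_mono_left: "\<lbrakk>x \<in> carrier A; y \<in> carrier A; z \<in> carrier A; x \<^bold>\<le> y\<rbrakk>
      \<Longrightarrow> x \<otimes> z \<^bold>\<le> y \<otimes> z"
    and mult_mono_right: "\<lbrakk>x \<in> carrier A; y \<in> carrier A; z \<in> carrier A; x \<^bold>\<le> y\<rbrakk>
      \<Longrightarrow> z \<otimes> x \<^bold>\<le> z \<otimes> y"
    and l_mult_le_one: "x \<in> carrier A \<Longrightarrow> \<l> x \<otimes> x \<^bold>\<le> \<one>"
    and one_le_mult_l: "x \<in> carrier A \<Longrightarrow> \<one> \<^bold>\<le> x \<otimes> \<l> x"
    and mult_r_le_one: "x \<in> carrier A \<Longrightarrow> x \<otimes> \<r> x \<^bold>\<le> \<one>"
    and one_le_r_mult: "x \<in> carrier A \<Longrightarrow> \<one> \<^bold>\<le> \<r> x \<otimes> x"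

locale distributive_lpregroup = lpregroup A for A (structure) +
  assumes meet_join_distrib: "\<lbrakk>x \<in> carrier A; y \<in> carrier A; z \<in> carrier A\<rbrakk>
      \<Longrightarrow> x \<^bold>\<and> (y \<^bold>\<or> z) = (x \<^bold>\<and> y) \<^bold>\<or> (x \<^bold>\<and> z)"

section \<open>Equations in the language of l-pregroups\<close>

datatype lp_term =
    Var nat
  | One
  | Meet lp_term lp_term
  | Join lp_term lp_term
  | Mult lp_term lp_term
  | L lp_term
  | R lp_term

type_synonym lp_equation = "lp_term \<times> lp_term"

text \<open>Length is the number of occurrences of variables and of operation symbols (the constant 1
  included); the operations l and r count once for every application.\<close>

fun term_length :: "lp_term \<Rightarrow> nat" where
  "term_length (Var i) = 1"
| "term_length One = 1"
| "term_length (Meet s t) = term_length s + term_length t + 1"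
| "term_length (Join s t) = term_length s + term_length t + 1"
| "term_length (Mult s t) = term_length s + term_length t + 1"
| "term_length (L t) = term_length t + 1"
| "term_length (R t) = term_length t + 1"

definition eq_length :: "lp_equation \<Rightarrow> nat" where
  "eq_length \<epsilon> = term_length (fst \<epsilon>) + term_length (snd \<epsilon>)"

fun eval_term :: "('a, 'm) lpregroup_scheme \<Rightarrow> (nat \<Rightarrow> 'a) \<Rightarrow> lp_term \<Rightarrow> 'a" where
  "eval_term A v (Var i) = v i"
| "eval_term A v One = \<one>\<^bsub>A\<^esub>"
| "eval_term A v (Meet s t) = eval_term A v s \<^bold>\<and>\<^bsub>A\<^esub> eval_term A v t"
| "eval_term A v (Join s t) = eval_term A v s \<^bold>\<or>\<^bsub>A\<^esub> eval_term A v t"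
| "eval_term A v (Mult s t) = eval_term A v s \<otimes>\<^bsub>A\<^esub> eval_term A v t"
| "eval_term A v (L t) = \<l>\<^bsub>A\<^esub> (eval_term A v t)"
| "eval_term A v (R t) = \<r>\<^bsub>A\<^esub> (eval_term A v t)"

definition fails_in :: "lp_equation \<Rightarrow> ('a, 'm) lpregroup_scheme \<Rightarrow> bool" where
  "fails_in \<epsilon> A \<longleftrightarrow>
    (\<exists>v. (\<forall>i. v i \<in> carrier A) \<and> eval_term A v (fst \<epsilon>) \<noteq> eval_term A v (snd \<epsilon>))"

text \<open>HOL cannot quantify over the types that carry the members of a class of algebras, so
  failure in the variety of distributive l-pregroups is relative to a type: the carriers range
  over all subsets of that type. The type should be infinite: a finite one would only admit
  algebras of bounded finite size.\<close>

definition fails_in_DLP :: "'a itself \<Rightarrow> lp_equation \<Rightarrow> bool" where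
  "fails_in_DLP _ \<epsilon> \<longleftrightarrow> (\<exists>A :: 'a lpregroup. distributive_lpregroup A \<and> fails_in \<epsilon> A)"

section \<open>The l-pregroups of maps on the integers\<close>

definition has_residual :: "(int \<Rightarrow> int) \<Rightarrow> bool" where
  "has_residual f \<longleftrightarrow> (\<exists>g. \<forall>a b. f a \<le> b \<longleftrightarrow> a \<le> g b)"

definition has_dual_residual :: "(int \<Rightarrow> int) \<Rightarrow> bool" where
  "has_dual_residual f \<longleftrightarrow> (\<exists>g. \<forall>a b. a \<le> f b \<longleftrightarrow> g a \<le> b)"

definition residual :: "(int \<Rightarrow> int) \<Rightarrow> int \<Rightarrow> int" where
  "residual f b = (GREATEST a. f a \<le> b)"

definition dual_residual :: "(int \<Rightarrow> int) \<Rightarrow> int \<Rightarrow> int" where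
  "dual_residual f a = (LEAST b. a \<le> f b)"

lemma residual_galois:
  assumes "has_residual f"
  shows "f a \<le> b \<longleftrightarrow> a \<le> residual f b"
proof -
  obtain g where g: "\<And>a b. f a \<le> b \<longleftrightarrow> a \<le> g b"
    using assms unfolding has_residual_def by blast
  have "residual f b = g b"
    unfolding residual_def by (rule Greatest_equality) (use g in auto)
  then show ?thesis using g by simp
qed

lemma dual_residual_galois:
  assumes "has_dual_residual f"
  shows "a \<le> f b \<longleftrightarrow> dual_residual f a \<le> b"
proof -
  obtain g where g: "\<And>a b. a \<le> f b \<longleftrightarrow> g a \<le> b"
    using assms unfolding has_dual_residual_def by blast
  have "dual_residual f a = g a"
    unfolding dual_residual_def by (rule Least_equality) (use g in auto)
  then show ?thesis using g by simp
qed

definition F_Z :: "(int \<Rightarrow> int) lpregroup" where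
  "F_Z = \<lparr>carrier = {f. \<forall>k. has_residual ((residual ^^ k) f) \<and>
                            has_dual_residual ((dual_residual ^^ k) f)},
    mult = (\<circ>), one = id,
    lp_meet = (\<lambda>f g x. min (f x) (g x)), lp_join = (\<lambda>f g x. max (f x) (g x)),
    lp_l = dual_residual, lp_r = residual\<rparr>"

definition Fn_Z :: "nat \<Rightarrow> (int \<Rightarrow> int) lpregroup" where
  "Fn_Z n = F_Z\<lparr>carrier := {f \<in> carrier F_Z. (lp_l F_Z ^^ n) f = (lp_r F_Z ^^ n) f}\<rparr>"

end

theory Submission
  imports Defs "HOL-Library.Countable"
begin

text \<open>In a distributive l-pregroup \<open>A\<close> right multiplication by an element preserves meets and
  joins and has residuals, so \<open>a \<mapsto> (P \<mapsto> {x. x a \<in> P})\<close> is an action on prime filters that turns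
  \<open>l\<close> and \<open>r\<close> into dual residuals and residuals; since a union of two filters is a filter only if
  they are comparable, every orbit is a chain. A failing equation thus fails at a point of a chain,
  where only linearly many applications of iterated residuals \<open>f\<^bsup>(m)\<^esup>\<close> of the maps assigned to
  variables are involved. On the integers \<open>f\<^bsup>(2k)\<^esup>(x) = f(x + k) - k\<close>. Write \<open>p + e \<le> q\<close> if the chain
  has a strictly increasing sequence of \<open>e\<close> steps from \<open>p\<close> to a point below \<open>q\<close>, and \<open>p - e \<le> q\<close> if not
  \<open>q + (e + 1) \<le> p\<close>. On every chain \<open>p + e \<le> q\<close> implies \<open>f\<^bsup>(2e)\<^esup>(p) + e \<le> f(q)\<close>. Hence an embedding of
  the finitely many relevant points into the integers that preserves and reflects the relations
  \<open>p + e \<le> q\<close> for small \<open>e\<close> transports the values to monotone partial maps. These extend to monotone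
  maps with \<open>f(x + n) = f(x) + n\<close> as soon as \<open>n\<close> exceeds a quadratic function of the length of the
  equation; for even \<open>n > 0\<close> such maps belong to \<open>F\<^sub>n(\<int>)\<close>.\<close>

section \<open>Iterated residuals in l-pregroups\<close>

text \<open>A single integer index serves both operations because \<open>l\<close> and
  \<open>r\<close> are mutually inverse; they shift the index by \<open>-1\<close> and
  \<open>+1\<close>.\<close>

definition res_pow :: "('a, 'm) lpregroup_scheme \<Rightarrow> int \<Rightarrow> 'a \<Rightarrow> 'a" where
  "res_pow A m a = (if 0 \<le> m then (lp_r A ^^ nat m) a else (lp_l A ^^ nat (- m)) a)"

context lpregroup
begin

section \<open>The lattice order\<close>

lemma meet_idem: "x \<in> carrier A \<Longrightarrow> x \<^bold>\<and> x = x"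
  by (metis join_meet_absorb meet_closed meet_join_absorb)

lemma le_refl: "x \<in> carrier A \<Longrightarrow> x \<^bold>\<le> x"
  by (simp add: lp_le_def meet_idem)

lemma le_antisym: "\<lbrakk>x \<in> carrier A; y \<in> carrier A; x \<^bold>\<le> y; y \<^bold>\<le> x\<rbrakk> \<Longrightarrow> x = y"
  by (metis lp_le_def meet_commute)

lemma le_trans: "\<lbrakk>x \<in> carrier A; y \<in> carrier A; z \<in> carrier A; x \<^bold>\<le> y; y \<^bold>\<le> z\<rbrakk> \<Longrightarrow> x \<^bold>\<le> z"
  by (metis lp_le_def meet_assoc)

lemma meet_le1: "\<lbrakk>x \<in> carrier A; y \<in> carrier A\<rbrakk> \<Longrightarrow> x \<^bold>\<and> y \<^bold>\<le> x"
  by (metis lp_le_def meet_assoc meet_commute meet_idem)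

lemma meet_le2: "\<lbrakk>x \<in> carrier A; y \<in> carrier A\<rbrakk> \<Longrightarrow> x \<^bold>\<and> y \<^bold>\<le> y"
  by (metis meet_commute meet_le1)

lemma le_meetI: "\<lbrakk>x \<in> carrier A; y \<in> carrier A; z \<in> carrier A; z \<^bold>\<le> x; z \<^bold>\<le> y\<rbrakk> \<Longrightarrow> z \<^bold>\<le> x \<^bold>\<and> y"
  by (metis lp_le_def meet_assoc)

lemma meet_mono:
  assumes [simp]: "x \<in> carrier A" "y \<in> carrier A" "x' \<in> carrier A" "y' \<in> carrier A"
    and "x \<^bold>\<le> x'" "y \<^bold>\<le> y'"
  shows "x \<^bold>\<and> y \<^bold>\<le> x' \<^bold>\<and> y'"
proof (rule le_meetI)
  show "x \<^bold>\<and> y \<^bold>\<le> x'"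
    by (rule le_trans[OF _ _ _ meet_le1[of x y]]) (simp_all add: assms meet_closed)
  show "x \<^bold>\<and> y \<^bold>\<le> y'"
    by (rule le_trans[OF _ _ _ meet_le2[of x y]]) (simp_all add: assms meet_closed)
qed (simp_all add: meet_closed)

lemma le_iff_join: "\<lbrakk>x \<in> carrier A; y \<in> carrier A\<rbrakk> \<Longrightarrow> x \<^bold>\<le> y \<longleftrightarrow> x \<^bold>\<or> y = y"
  by (metis lp_le_def join_commute join_meet_absorb meet_commute meet_join_absorb)

lemma join_ge1: "\<lbrakk>x \<in> carrier A; y \<in> carrier A\<rbrakk> \<Longrightarrow> x \<^bold>\<le> x \<^bold>\<or> y"
  by (simp add: lp_le_def meet_join_absorb)

lemma join_ge2: "\<lbrakk>x \<in> carrier A; y \<in> carrier A\<rbrakk> \<Longrightarrow> y \<^bold>\<le> x \<^bold>\<or> y"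
  by (metis join_commute join_ge1)

lemma join_leI: "\<lbrakk>x \<in> carrier A; y \<in> carrier A; z \<in> carrier A; x \<^bold>\<le> z; y \<^bold>\<le> z\<rbrakk> \<Longrightarrow> x \<^bold>\<or> y \<^bold>\<le> z"
  by (simp add: le_iff_join join_assoc join_closed)

section \<open>Residuals as adjoints and distribution of products over the lattice
  operations\<close>

lemmas op_closed = m_closed one_closed meet_closed join_closed l_closed r_closed

text \<open>Uniqueness of adjoints: \<open>b \<le> (r a) a b \<le> r a\<close> and, symmetrically,
  \<open>r a \<le> b a (r a) \<le> b\<close>.\<close>

lemma r_unique:
  assumes [simp]: "a \<in> carrier A" "b \<in> carrier A" and "a \<otimes> b \<^bold>\<le> \<one>" "\<one> \<^bold>\<le> b \<otimes> a"
  shows "b = \<r> a"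
proof (rule le_antisym)
  have "\<one> \<otimes> b \<^bold>\<le> (\<r> a \<otimes> a) \<otimes> b" by (intro mult_mono_left one_le_r_mult) (simp_all add: op_closed)
  moreover have "\<r> a \<otimes> (a \<otimes> b) \<^bold>\<le> \<r> a \<otimes> \<one>"
    by (intro mult_mono_right assms) (simp_all add: op_closed)
  ultimately show "b \<^bold>\<le> \<r> a"
    using le_trans[of b "\<r> a \<otimes> (a \<otimes> b)" "\<r> a"] by (simp add: op_closed m_assoc)
  have "\<one> \<otimes> \<r> a \<^bold>\<le> (b \<otimes> a) \<otimes> \<r> a" by (intro mult_mono_left assms) (simp_all add: op_closed)
  moreover have "b \<otimes> (a \<otimes> \<r> a) \<^bold>\<le> b \<otimes> \<one>"
    by (intro mult_mono_right mult_r_le_one) (simp_all add: op_closed)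
  ultimately show "\<r> a \<^bold>\<le> b"
    using le_trans[of "\<r> a" "b \<otimes> (a \<otimes> \<r> a)" b] by (simp add: op_closed m_assoc)
qed (simp_all add: op_closed)

lemma r_l: "a \<in> carrier A \<Longrightarrow> \<r> (\<l> a) = a"
  by (intro r_unique[symmetric] l_mult_le_one one_le_mult_l op_closed)

lemma l_unique:
  assumes [simp]: "a \<in> carrier A" "b \<in> carrier A" and "b \<otimes> a \<^bold>\<le> \<one>" "\<one> \<^bold>\<le> a \<otimes> b"
  shows "b = \<l> a"
proof (rule le_antisym)
  have "b \<otimes> \<one> \<^bold>\<le> b \<otimes> (a \<otimes> \<l> a)"
    by (intro mult_mono_right one_le_mult_l) (simp_all add: op_closed)
  moreover have "(b \<otimes> a) \<otimes> \<l> a \<^bold>\<le> \<one> \<otimes> \<l> a"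
    by (intro mult_mono_left assms) (simp_all add: op_closed)
  ultimately show "b \<^bold>\<le> \<l> a"
    using le_trans[of b "b \<otimes> (a \<otimes> \<l> a)" "\<l> a"] by (simp add: op_closed m_assoc)
  have "\<l> a \<otimes> \<one> \<^bold>\<le> \<l> a \<otimes> (a \<otimes> b)" by (intro mult_mono_right assms) (simp_all add: op_closed)
  moreover have "(\<l> a \<otimes> a) \<otimes> b \<^bold>\<le> \<one> \<otimes> b"
    by (intro mult_mono_left l_mult_le_one) (simp_all add: op_closed)
  ultimately show "\<l> a \<^bold>\<le> b"
    using le_trans[of "\<l> a" "\<l> a \<otimes> (a \<otimes> b)" b] by (simp add: op_closed m_assoc)
qed (simp_all add: op_closed)

lemma l_r: "a \<in> carrier A \<Longrightarrow> \<l> (\<r> a) = a"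
  by (intro l_unique[symmetric] mult_r_le_one one_le_r_mult op_closed)

lemma mult_le_iff_left:
  assumes [simp]: "a \<in> carrier A" "x \<in> carrier A" "y \<in> carrier A"
  shows "a \<otimes> x \<^bold>\<le> y \<longleftrightarrow> x \<^bold>\<le> \<r> a \<otimes> y"
proof
  assume "a \<otimes> x \<^bold>\<le> y"
  then have "\<r> a \<otimes> (a \<otimes> x) \<^bold>\<le> \<r> a \<otimes> y" by (intro mult_mono_right) (simp_all add: op_closed)
  moreover have "\<one> \<otimes> x \<^bold>\<le> (\<r> a \<otimes> a) \<otimes> x"
    by (intro mult_mono_left one_le_r_mult) (simp_all add: op_closed)
  ultimately show "x \<^bold>\<le> \<r> a \<otimes> y"
    using le_trans[of x "\<r> a \<otimes> (a \<otimes> x)" "\<r> a \<otimes> y"] by (simp add: op_closed m_assoc)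
next
  assume "x \<^bold>\<le> \<r> a \<otimes> y"
  then have "a \<otimes> x \<^bold>\<le> a \<otimes> (\<r> a \<otimes> y)" by (intro mult_mono_right) (simp_all add: op_closed)
  moreover have "(a \<otimes> \<r> a) \<otimes> y \<^bold>\<le> \<one> \<otimes> y"
    by (intro mult_mono_left mult_r_le_one) (simp_all add: op_closed)
  ultimately show "a \<otimes> x \<^bold>\<le> y"
    using le_trans[of "a \<otimes> x" "a \<otimes> (\<r> a \<otimes> y)" y] by (simp add: op_closed m_assoc)
qed

text \<open>Right multiplication by \<open>a\<close> thus has a lower adjoint, multiplication by
  \<open>r a\<close>, and through \<open>r_l\<close> also an upper adjoint, multiplication by
  \<open>l a\<close>.\<close>

lemma mult_le_iff_right:
  assumes [simp]: "a \<in> carrier A" "x \<in> carrier A" "y \<in> carrier A"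
  shows "x \<otimes> \<r> a \<^bold>\<le> y \<longleftrightarrow> x \<^bold>\<le> y \<otimes> a"
proof
  assume "x \<otimes> \<r> a \<^bold>\<le> y"
  then have "(x \<otimes> \<r> a) \<otimes> a \<^bold>\<le> y \<otimes> a" by (intro mult_mono_left) (simp_all add: op_closed)
  moreover have "x \<otimes> \<one> \<^bold>\<le> x \<otimes> (\<r> a \<otimes> a)"
    by (intro mult_mono_right one_le_r_mult) (simp_all add: op_closed)
  ultimately show "x \<^bold>\<le> y \<otimes> a"
    using le_trans[of x "x \<otimes> (\<r> a \<otimes> a)" "y \<otimes> a"] by (simp add: op_closed m_assoc)
next
  assume "x \<^bold>\<le> y \<otimes> a"
  then have "x \<otimes> \<r> a \<^bold>\<le> (y \<otimes> a) \<otimes> \<r> a" by (intro mult_mono_left) (simp_all add: op_closed)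
  moreover have "y \<otimes> (a \<otimes> \<r> a) \<^bold>\<le> y \<otimes> \<one>"
    by (intro mult_mono_right mult_r_le_one) (simp_all add: op_closed)
  ultimately show "x \<otimes> \<r> a \<^bold>\<le> y"
    using le_trans[of "x \<otimes> \<r> a" "y \<otimes> (a \<otimes> \<r> a)" y] by (simp add: op_closed m_assoc)
qed

text \<open>Lower adjoints preserve joins. The next three lemmas follow the same pattern; upper
  adjoints preserve meets.\<close>

lemma mult_join_distrib:
  assumes [simp]: "a \<in> carrier A" "x \<in> carrier A" "y \<in> carrier A"
  shows "a \<otimes> (x \<^bold>\<or> y) = (a \<otimes> x) \<^bold>\<or> (a \<otimes> y)"
proof (rule le_antisym)
  show "a \<otimes> (x \<^bold>\<or> y) \<^bold>\<le> (a \<otimes> x) \<^bold>\<or> (a \<otimes> y)"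
    by (subst mult_le_iff_left; (intro join_leI mult_le_iff_left[THEN iffD1] join_ge1 join_ge2)?)
      (simp_all add: op_closed)
  show "(a \<otimes> x) \<^bold>\<or> (a \<otimes> y) \<^bold>\<le> a \<otimes> (x \<^bold>\<or> y)"
    by (intro join_leI mult_mono_right) (simp_all add: op_closed join_ge1 join_ge2)
qed (simp_all add: op_closed)

lemma mult_meet_distrib:
  assumes [simp]: "a \<in> carrier A" "x \<in> carrier A" "y \<in> carrier A"
  shows "a \<otimes> (x \<^bold>\<and> y) = (a \<otimes> x) \<^bold>\<and> (a \<otimes> y)"
proof (rule le_antisym)
  have *: "z \<^bold>\<le> a \<otimes> w \<longleftrightarrow> \<l> a \<otimes> z \<^bold>\<le> w" if "z \<in> carrier A" "w \<in> carrier A" for z w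
    using that mult_le_iff_left[of "\<l> a" z w] by (simp add: op_closed r_l)
  show "(a \<otimes> x) \<^bold>\<and> (a \<otimes> y) \<^bold>\<le> a \<otimes> (x \<^bold>\<and> y)"
    by (subst *; (intro le_meetI *[THEN iffD1] meet_le1 meet_le2)?) (simp_all add: op_closed)
  show "a \<otimes> (x \<^bold>\<and> y) \<^bold>\<le> (a \<otimes> x) \<^bold>\<and> (a \<otimes> y)"
    by (intro le_meetI mult_mono_right) (simp_all add: op_closed meet_le1 meet_le2)
qed (simp_all add: op_closed)

lemma meet_mult_distrib:
  assumes [simp]: "a \<in> carrier A" "x \<in> carrier A" "y \<in> carrier A"
  shows "(x \<^bold>\<and> y) \<otimes> a = (x \<otimes> a) \<^bold>\<and> (y \<otimes> a)"
proof (rule le_antisym)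
  show "(x \<otimes> a) \<^bold>\<and> (y \<otimes> a) \<^bold>\<le> (x \<^bold>\<and> y) \<otimes> a"
    by (subst mult_le_iff_right[symmetric];
        (intro le_meetI mult_le_iff_right[THEN iffD2] meet_le1 meet_le2)?)
      (simp_all add: op_closed)
  show "(x \<^bold>\<and> y) \<otimes> a \<^bold>\<le> (x \<otimes> a) \<^bold>\<and> (y \<otimes> a)"
    by (intro le_meetI mult_mono_left) (simp_all add: op_closed meet_le1 meet_le2)
qed (simp_all add: op_closed)

lemma join_mult_distrib:
  assumes [simp]: "a \<in> carrier A" "x \<in> carrier A" "y \<in> carrier A"
  shows "(x \<^bold>\<or> y) \<otimes> a = (x \<otimes> a) \<^bold>\<or> (y \<otimes> a)"
proof (rule le_antisym)
  have *: "z \<otimes> a \<^bold>\<le> w \<longleftrightarrow> z \<^bold>\<le> w \<otimes> \<l> a" if "z \<in> carrier A" "w \<in> carrier A" for z w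
    using that mult_le_iff_right[of "\<l> a" z w] by (simp add: op_closed r_l)
  show "(x \<^bold>\<or> y) \<otimes> a \<^bold>\<le> (x \<otimes> a) \<^bold>\<or> (y \<otimes> a)"
    by (subst *; (intro join_leI *[THEN iffD1] join_ge1 join_ge2)?) (simp_all add: op_closed)
  show "(x \<otimes> a) \<^bold>\<or> (y \<otimes> a) \<^bold>\<le> (x \<^bold>\<or> y) \<otimes> a"
    by (intro join_leI mult_mono_left) (simp_all add: op_closed join_ge1 join_ge2)
qed (simp_all add: op_closed)

section \<open>Residuals of products, meets and joins\<close>

lemma r_antimono:
  assumes [simp]: "a \<in> carrier A" "b \<in> carrier A" and "a \<^bold>\<le> b"
  shows "\<r> b \<^bold>\<le> \<r> a"
proof -
  have "a \<otimes> \<r> b \<^bold>\<le> b \<otimes> \<r> b" by (intro mult_mono_left assms) (simp_all add: op_closed)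
  then have "a \<otimes> \<r> b \<^bold>\<le> \<one>"
    using le_trans[of "a \<otimes> \<r> b" "b \<otimes> \<r> b" \<one>] by (simp add: op_closed mult_r_le_one)
  then show ?thesis
    by (subst (asm) mult_le_iff_left) (simp_all add: op_closed)
qed

lemma l_antimono:
  assumes [simp]: "a \<in> carrier A" "b \<in> carrier A" and "a \<^bold>\<le> b"
  shows "\<l> b \<^bold>\<le> \<l> a"
proof -
  have "\<l> b \<otimes> a \<^bold>\<le> \<l> b \<otimes> b" by (intro mult_mono_right assms) (simp_all add: op_closed)
  then have "\<l> b \<otimes> \<r> (\<l> a) \<^bold>\<le> \<one>"
    using le_trans[of "\<l> b \<otimes> a" "\<l> b \<otimes> b" \<one>] by (simp add: op_closed l_mult_le_one r_l)
  then show ?thesis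
    by (subst (asm) mult_le_iff_right) (simp_all add: op_closed)
qed

lemma r_of_one: "\<r> \<one> = \<one>"
  by (rule r_unique[symmetric]) (simp_all add: le_refl)

lemma l_of_one: "\<l> \<one> = \<one>"
  by (rule l_unique[symmetric]) (simp_all add: le_refl)

lemma r_mult:
  assumes [simp]: "a \<in> carrier A" "b \<in> carrier A"
  shows "\<r> (a \<otimes> b) = \<r> b \<otimes> \<r> a"
proof (rule r_unique[symmetric])
  have "(b \<otimes> \<r> b) \<otimes> \<r> a \<^bold>\<le> \<one> \<otimes> \<r> a"
    by (intro mult_mono_left mult_r_le_one) (simp_all add: op_closed)
  then have "b \<otimes> (\<r> b \<otimes> \<r> a) \<^bold>\<le> \<r> a \<otimes> \<one>"
    by (simp add: m_assoc op_closed)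
  then show "(a \<otimes> b) \<otimes> (\<r> b \<otimes> \<r> a) \<^bold>\<le> \<one>"
    by (subst (asm) mult_le_iff_left[symmetric]) (simp_all add: op_closed m_assoc)
  have "b \<otimes> \<one> \<^bold>\<le> \<r> a \<otimes> (a \<otimes> b)"
    by (simp add: mult_le_iff_left[symmetric] op_closed le_refl)
  then show "\<one> \<^bold>\<le> (\<r> b \<otimes> \<r> a) \<otimes> (a \<otimes> b)"
    by (subst (asm) mult_le_iff_left) (simp_all add: op_closed m_assoc)
qed (simp_all add: op_closed)

lemma l_mult:
  assumes [simp]: "a \<in> carrier A" "b \<in> carrier A"
  shows "\<l> (a \<otimes> b) = \<l> b \<otimes> \<l> a"
proof -
  have "\<r> (\<l> b \<otimes> \<l> a) = a \<otimes> b"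
    by (simp add: r_mult op_closed r_l)
  then show ?thesis
    by (metis l_r assms l_closed m_closed)
qed

text \<open>Since \<open>r\<close> and \<open>l\<close> are mutually inverse and both reverse the
  order, each exchanges meets and joins.\<close>

lemma r_meet:
  assumes [simp]: "a \<in> carrier A" "b \<in> carrier A"
  shows "\<r> (a \<^bold>\<and> b) = \<r> a \<^bold>\<or> \<r> b"
proof (rule le_antisym)
  have "\<l> (\<r> a \<^bold>\<or> \<r> b) \<^bold>\<le> \<l> (\<r> a)" "\<l> (\<r> a \<^bold>\<or> \<r> b) \<^bold>\<le> \<l> (\<r> b)"
    by (intro l_antimono; simp add: op_closed join_ge1 join_ge2)+
  then have "\<r> (a \<^bold>\<and> b) \<^bold>\<le> \<r> (\<l> (\<r> a \<^bold>\<or> \<r> b))"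
    by (intro r_antimono le_meetI) (simp_all add: op_closed l_r)
  then show "\<r> (a \<^bold>\<and> b) \<^bold>\<le> \<r> a \<^bold>\<or> \<r> b"
    by (simp add: r_l op_closed)
  show "\<r> a \<^bold>\<or> \<r> b \<^bold>\<le> \<r> (a \<^bold>\<and> b)"
    by (intro join_leI r_antimono) (simp_all add: op_closed meet_le1 meet_le2)
qed (simp_all add: op_closed)

lemma r_join:
  assumes [simp]: "a \<in> carrier A" "b \<in> carrier A"
  shows "\<r> (a \<^bold>\<or> b) = \<r> a \<^bold>\<and> \<r> b"
proof (rule le_antisym)
  have "\<l> (\<r> a) \<^bold>\<le> \<l> (\<r> a \<^bold>\<and> \<r> b)" "\<l> (\<r> b) \<^bold>\<le> \<l> (\<r> a \<^bold>\<and> \<r> b)"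
    by (intro l_antimono; simp add: op_closed meet_le1 meet_le2)+
  then have "\<r> (\<l> (\<r> a \<^bold>\<and> \<r> b)) \<^bold>\<le> \<r> (a \<^bold>\<or> b)"
    by (intro r_antimono join_leI) (simp_all add: op_closed l_r)
  then show "\<r> a \<^bold>\<and> \<r> b \<^bold>\<le> \<r> (a \<^bold>\<or> b)"
    by (simp add: r_l op_closed)
  show "\<r> (a \<^bold>\<or> b) \<^bold>\<le> \<r> a \<^bold>\<and> \<r> b"
    by (intro le_meetI r_antimono) (simp_all add: op_closed join_ge1 join_ge2)
qed (simp_all add: op_closed)

lemma l_meet:
  assumes [simp]: "a \<in> carrier A" "b \<in> carrier A"
  shows "\<l> (a \<^bold>\<and> b) = \<l> a \<^bold>\<or> \<l> b"
  by (metis assms l_closed l_r join_closed r_join r_l)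

lemma l_join:
  assumes [simp]: "a \<in> carrier A" "b \<in> carrier A"
  shows "\<l> (a \<^bold>\<or> b) = \<l> a \<^bold>\<and> \<l> b"
  by (metis assms l_closed l_r meet_closed r_meet r_l)

section \<open>Calculus of iterated residuals\<close>

lemma res_pow_0 [simp]: "res_pow A 0 a = a"
  by (simp add: res_pow_def)

lemma res_pow_closed:
  assumes "a \<in> carrier A"
  shows "res_pow A m a \<in> carrier A"
proof -
  have "(lp_r A ^^ k) a \<in> carrier A" "(lp_l A ^^ k) a \<in> carrier A" for k
    by (induction k) (simp_all add: assms op_closed)
  then show ?thesis
    by (simp add: res_pow_def)
qed

lemma r_res_pow:
  assumes "a \<in> carrier A"
  shows "\<r> (res_pow A m a) = res_pow A (m + 1) a"
proof (cases "0 \<le> m")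
  case True
  then show ?thesis
    by (simp add: res_pow_def nat_add_distrib)
next
  case False
  then have "nat (- m) = Suc (nat (- (m + 1)))"
    by simp
  moreover have "(lp_l A ^^ k) a \<in> carrier A" for k
    by (induction k) (simp_all add: assms op_closed)
  ultimately show ?thesis
    using False by (auto simp add: res_pow_def r_l)
qed

lemma l_res_pow:
  assumes "a \<in> carrier A"
  shows "\<l> (res_pow A m a) = res_pow A (m - 1) a"
  using r_res_pow[OF assms, of "m - 1"] l_r[OF res_pow_closed[OF assms], of "m - 1"] by simp

text \<open>The shift takes place at the innermost application here; this is what pushes outer
  residuals past an \<open>R\<close> occurring in a term.\<close>

lemma res_pow_r:
  assumes "a \<in> carrier A"
  shows "res_pow A m (\<r> a) = res_pow A (m + 1) a"
proof (induction m rule: int_induct[where k = 0])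
  case base
  show ?case using r_res_pow[OF assms, of 0] by simp
next
  case (step1 i)
  then show ?case
    using r_res_pow[OF assms, of "i + 1"] r_res_pow[OF r_closed[OF assms], of i] by simp
next
  case (step2 i)
  then show ?case
    using l_res_pow[OF assms, of "i + 1"] l_res_pow[OF r_closed[OF assms], of i] by simp
qed

lemma res_pow_l:
  assumes "a \<in> carrier A"
  shows "res_pow A m (\<l> a) = res_pow A (m - 1) a"
  using res_pow_r[of "\<l> a" "m - 1"] by (simp add: assms op_closed r_l)

lemma res_pow_one: "res_pow A m \<one> = \<one>"
proof (induction m rule: int_induct[where k = 0])
  case (step1 i)
  then show ?case by (simp add: r_res_pow[symmetric] r_of_one)
next
  case (step2 i)
  then show ?case by (simp add: l_res_pow[symmetric] l_of_one)
qed simp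

text \<open>Each single residual reverses the product, so only the parity of \<open>m\<close>
  matters; likewise for the exchange of meet and join below.\<close>

lemma res_pow_mult:
  assumes "a \<in> carrier A" "b \<in> carrier A"
  shows "res_pow A m (a \<otimes> b) =
    (if even m then res_pow A m a \<otimes> res_pow A m b else res_pow A m b \<otimes> res_pow A m a)"
proof (induction m rule: int_induct[where k = 0])
  case (step1 i)
  then show ?case
    by (simp add: r_res_pow[symmetric] r_mult res_pow_closed assms op_closed)
next
  case (step2 i)
  then show ?case
    by (simp add: l_res_pow[symmetric] l_mult res_pow_closed assms op_closed)
qed simp

lemma res_pow_meet:
  assumes "a \<in> carrier A" "b \<in> carrier A"
  shows "res_pow A m (a \<^bold>\<and> b) =
    (if even m then res_pow A m a \<^bold>\<and> res_pow A m b else res_pow A m a \<^bold>\<or> res_pow A m b)"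
proof (induction m rule: int_induct[where k = 0])
  case (step1 i)
  then show ?case
    by (simp add: r_res_pow[symmetric] r_meet r_join res_pow_closed assms op_closed)
next
  case (step2 i)
  then show ?case
    by (simp add: l_res_pow[symmetric] l_meet l_join res_pow_closed assms op_closed)
qed simp

lemma res_pow_join:
  assumes "a \<in> carrier A" "b \<in> carrier A"
  shows "res_pow A m (a \<^bold>\<or> b) =
    (if even m then res_pow A m a \<^bold>\<or> res_pow A m b else res_pow A m a \<^bold>\<and> res_pow A m b)"
proof (induction m rule: int_induct[where k = 0])
  case (step1 i)
  then show ?case
    by (simp add: r_res_pow[symmetric] r_meet r_join res_pow_closed assms op_closed)
next
  case (step2 i)
  then show ?case
    by (simp add: l_res_pow[symmetric] l_meet l_join res_pow_closed assms op_closed)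
qed simp

lemma eval_term_closed: "(\<And>i. v i \<in> carrier A) \<Longrightarrow> eval_term A v t \<in> carrier A"
  by (induction t) (simp_all add: op_closed)

end

section \<open>Terms as maps on a lattice\<close>

text \<open>\<open>term_map F t m\<close> is the map \<open>t\<^bsup>(m)\<^esup>\<close>, the \<open>m\<close>-fold residual of the term \<open>t\<close> (dual residuals for
  negative \<open>m\<close>), with residuals pushed down to the variables; \<open>F i m\<close> interprets \<open>x\<^sub>i\<^bsup>(m)\<^esup>\<close>.\<close>

fun term_map :: "(nat \<Rightarrow> int \<Rightarrow> 'x \<Rightarrow> 'x::lattice) \<Rightarrow> lp_term \<Rightarrow> int \<Rightarrow> 'x \<Rightarrow> 'x" where
  "term_map F (Var i) m x = F i m x"
| "term_map F One m x = x"
| "term_map F (Meet s t) m x =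
    (if even m then inf (term_map F s m x) (term_map F t m x)
     else sup (term_map F s m x) (term_map F t m x))"
| "term_map F (Join s t) m x =
    (if even m then sup (term_map F s m x) (term_map F t m x)
     else inf (term_map F s m x) (term_map F t m x))"
| "term_map F (Mult s t) m x =
    (if even m then term_map F s m (term_map F t m x) else term_map F t m (term_map F s m x))"
| "term_map F (L t) m x = term_map F t (m - 1) x"
| "term_map F (R t) m x = term_map F t (m + 1) x"

text \<open>Residuals are moved to the variables before acting, so the action only has to respect
  unit, products, meets and joins. This covers the action on prime filters as well as that of
  \<open>F_Z\<close> on the integers.\<close>

lemma (in lpregroup) action_eval_term:
  fixes act :: "'a \<Rightarrow> 'x \<Rightarrow> 'x::lattice"
  assumes X: "\<And>a x. \<lbrakk>a \<in> carrier A; x \<in> X\<rbrakk> \<Longrightarrow> act a x \<in> X"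
    and one: "\<And>x. x \<in> X \<Longrightarrow> act \<one> x = x"
    and mult: "\<And>a b x. \<lbrakk>a \<in> carrier A; b \<in> carrier A; x \<in> X\<rbrakk> \<Longrightarrow> act (a \<otimes> b) x = act a (act b x)"
    and meet: "\<And>a b x. \<lbrakk>a \<in> carrier A; b \<in> carrier A; x \<in> X\<rbrakk>
      \<Longrightarrow> act (a \<^bold>\<and> b) x = inf (act a x) (act b x)"
    and join: "\<And>a b x. \<lbrakk>a \<in> carrier A; b \<in> carrier A; x \<in> X\<rbrakk>
      \<Longrightarrow> act (a \<^bold>\<or> b) x = sup (act a x) (act b x)"
    and v: "\<And>i. v i \<in> carrier A"
    and x: "x \<in> X"
  shows "act (res_pow A m (eval_term A v t)) x = term_map (\<lambda>i m. act (res_pow A m (v i))) t m x"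
  using x
proof (induction t arbitrary: m x)
  case (Mult s t)
  then show ?case
    by (simp add: res_pow_mult mult X res_pow_closed eval_term_closed v flip: Mult.IH)
qed (simp_all add: res_pow_one one res_pow_meet meet res_pow_join join
    res_pow_r res_pow_l res_pow_closed eval_term_closed v)

text \<open>The applications of literals \<open>x\<^sub>i\<^bsup>(m)\<^esup>\<close> to points that occur when \<open>t\<^bsup>(m)\<^esup>\<close> is evaluated at a point.\<close>

fun literals :: "(nat \<Rightarrow> int \<Rightarrow> 'x \<Rightarrow> 'x::lattice) \<Rightarrow> lp_term \<Rightarrow> int \<Rightarrow> 'x \<Rightarrow> (nat \<times> int \<times> 'x) set" where
  "literals F (Var i) m x = {(i, m, x)}"
| "literals F One m x = {}"
| "literals F (Meet s t) m x = literals F s m x \<union> literals F t m x"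
| "literals F (Join s t) m x = literals F s m x \<union> literals F t m x"
| "literals F (Mult s t) m x =
    (if even m then literals F t m x \<union> literals F s m (term_map F t m x)
     else literals F s m x \<union> literals F t m (term_map F s m x))"
| "literals F (L t) m x = literals F t (m - 1) x"
| "literals F (R t) m x = literals F t (m + 1) x"

lemma finite_literals: "finite (literals F t m x)"
  by (induction t arbitrary: m x) auto

text \<open>Each variable occurrence is evaluated at one point only, hence yields one literal;
  different occurrences may share it.\<close>

lemma card_literals: "card (literals F t m x) \<le> term_length t"
proof (induction t arbitrary: m x)
  case (Meet s t)
  show ?case
    using card_Un_le[of "literals F s m x" "literals F t m x"] Meet[of m x] by simp
next
  case (Join s t)
  show ?case
    using card_Un_le[of "literals F s m x" "literals F t m x"] Join[of m x] by simp
next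
  case (Mult s t)
  show ?case
    using card_Un_le[of "literals F t m x" "literals F s m (term_map F t m x)"]
      card_Un_le[of "literals F s m x" "literals F t m (term_map F s m x)"]
      Mult(1)[of m x] Mult(2)[of m x] Mult(1)[of m "term_map F t m x"]
      Mult(2)[of m "term_map F s m x"]
    by simp
qed (auto intro: le_SucI)

text \<open>Only \<open>L\<close> and \<open>R\<close> change the index, by one each.\<close>

lemma order_literals: "(i, k, y) \<in> literals F t m x \<Longrightarrow> \<bar>k\<bar> \<le> \<bar>m\<bar> + int (term_length t)"
  by (induction t arbitrary: m x) (force split: if_splits)+

text \<open>In a chain a meet or join is one of its arguments, so only literals can lead to new
  points.\<close>

lemma term_map_mem:
  assumes "\<And>x y. \<lbrakk>x \<in> D; y \<in> D\<rbrakk> \<Longrightarrow> x \<le> y \<or> y \<le> x"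
    and "\<And>i k y. (i, k, y) \<in> literals F t m x \<Longrightarrow> F i k y \<in> D" and "x \<in> D"
  shows "term_map F t m x \<in> D"
proof -
  have lat: "inf x y \<in> D \<and> sup x y \<in> D" if "x \<in> D" "y \<in> D" for x y
    using assms(1)[OF that] that by (auto simp: inf_absorb1 inf_absorb2 sup_absorb1 sup_absorb2)
  show ?thesis
    using assms(2,3)
  proof (induction t arbitrary: m x)
    case (Meet s t)
    then have "term_map F s m x \<in> D" "term_map F t m x \<in> D" by simp_all
    then show ?case using lat by simp
  next
    case (Join s t)
    then have "term_map F s m x \<in> D" "term_map F t m x \<in> D" by simp_all
    then show ?case using lat by simp
  next
    case (Mult s t)
    show ?case
    proof (cases "even m")
      case True
      with Mult.prems have "term_map F t m x \<in> D" by (intro Mult.IH) auto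
      with True Mult.prems show ?thesis by (auto intro!: Mult.IH)
    next
      case False
      with Mult.prems have "term_map F s m x \<in> D" by (intro Mult.IH) auto
      with False Mult.prems show ?thesis by (auto intro!: Mult.IH)
    qed
  qed auto
qed

text \<open>A monotone map on a chain preserves binary meets and joins, so compatibility on the
  literals suffices.\<close>

lemma term_map_transfer:
  fixes F :: "nat \<Rightarrow> int \<Rightarrow> 'x \<Rightarrow> 'x::lattice" and \<phi> :: "'x \<Rightarrow> int"
  assumes chain: "\<And>x y. \<lbrakk>x \<in> D; y \<in> D\<rbrakk> \<Longrightarrow> x \<le> y \<or> y \<le> x"
    and mono: "\<And>x y. \<lbrakk>x \<in> D; y \<in> D; x \<le> y\<rbrakk> \<Longrightarrow> \<phi> x \<le> \<phi> y"
    and "\<And>i k y. (i, k, y) \<in> literals F t m x \<Longrightarrow> F i k y \<in> D \<and> \<phi> (F i k y) = G i k (\<phi> y)"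
    and "x \<in> D"
  shows "\<phi> (term_map F t m x) = term_map G t m (\<phi> x)"
proof -
  have lat: "\<phi> (inf x y) = inf (\<phi> x) (\<phi> y) \<and> \<phi> (sup x y) = sup (\<phi> x) (\<phi> y)"
    if "x \<in> D" "y \<in> D" for x y
    using chain[OF that]
    by (auto simp: inf_absorb1 inf_absorb2 sup_absorb1 sup_absorb2 mono that)
  show ?thesis
    using assms(3,4)
  proof (induction t arbitrary: m x)
    case (Meet s t)
    then have "term_map F s m x \<in> D" "term_map F t m x \<in> D"
      by (intro term_map_mem[OF chain]; simp)+
    then show ?case using Meet lat by simp
  next
    case (Join s t)
    then have "term_map F s m x \<in> D" "term_map F t m x \<in> D"
      by (intro term_map_mem[OF chain]; simp)+
    then show ?case using Join lat by simp
  next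
    case (Mult s t)
    show ?case
    proof (cases "even m")
      case True
      with Mult.prems have "term_map F t m x \<in> D" by (intro term_map_mem[OF chain]) auto
      with True Mult.prems show ?thesis by (simp add: Mult.IH)
    next
      case False
      with Mult.prems have "term_map F s m x \<in> D" by (intro term_map_mem[OF chain]) auto
      with False Mult.prems show ?thesis by (simp add: Mult.IH)
    qed
  qed auto
qed

section \<open>Residuated families on a chain\<close>

text \<open>Totality is confined to \<open>Om\<close> because the intended order is inclusion of
  sets, which is total only on a suitable orbit.\<close>

locale residuated_family =
  fixes Om :: "'x::order set" and F :: "nat \<Rightarrow> int \<Rightarrow> 'x \<Rightarrow> 'x"
  assumes F_closed: "x \<in> Om \<Longrightarrow> F i m x \<in> Om"
    and total: "\<lbrakk>x \<in> Om; y \<in> Om\<rbrakk> \<Longrightarrow> x \<le> y \<or> y \<le> x"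
    and adjoint: "\<lbrakk>x \<in> Om; y \<in> Om\<rbrakk> \<Longrightarrow> F i m x \<le> y \<longleftrightarrow> x \<le> F i (m + 1) y"
begin

text \<open>\<open>steps e p q\<close> expresses \<open>p + e \<le> q\<close>: a strictly increasing sequence of \<open>e\<close> steps leads from
  \<open>p\<close> to a point below \<open>q\<close>.\<close>

fun steps :: "nat \<Rightarrow> 'x \<Rightarrow> 'x \<Rightarrow> bool" where
  "steps 0 p q \<longleftrightarrow> p \<le> q"
| "steps (Suc e) p q \<longleftrightarrow> (\<exists>c\<in>Om. p < c \<and> steps e c q)"

lemma not_le_iff: "\<lbrakk>x \<in> Om; y \<in> Om\<rbrakk> \<Longrightarrow> \<not> x \<le> y \<longleftrightarrow> y < x"
  using total by (auto simp: less_le_not_le)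

lemma steps_mono: "\<lbrakk>p' \<le> p; steps e p q; q \<le> q'\<rbrakk> \<Longrightarrow> steps e p' q'"
  by (induction e arbitrary: p p') (auto intro: order_trans order.strict_trans1)

lemma steps_le: "steps e p q \<Longrightarrow> p \<le> q"
  by (induction e arbitrary: p) (auto intro: order_trans less_imp_le)

lemma steps_add: "\<lbrakk>steps d p q; steps e q r\<rbrakk> \<Longrightarrow> steps (d + e) p r"
  by (induction d arbitrary: p) (auto intro: steps_mono)

lemma steps_less: "steps (Suc e) p q \<Longrightarrow> steps e p q"
  by (metis less_imp_le order_refl steps.simps(2) steps_mono)

lemma steps_antimono: "\<lbrakk>steps e p q; d \<le> e\<rbrakk> \<Longrightarrow> steps d p q"
  by (induction e) (auto simp: le_Suc_eq simp del: steps.simps dest: steps_less)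

text \<open>The point \<open>q\<close> cuts the sequence from \<open>p\<close> to \<open>r\<close>;
  compare it with the first point of the sequence and induct. Together with \<open>steps_add\<close>
  this makes maximal numbers of steps additive along the chain.\<close>

lemma steps_split:
  "\<lbrakk>steps (Suc (d + e)) p r; q \<in> Om\<rbrakk> \<Longrightarrow> steps (Suc d) p q \<or> steps (Suc e) q r"
proof (induction d arbitrary: p)
  case 0
  then obtain c where "c \<in> Om" "p < c" "steps e c r" by auto
  then show ?case
    using not_le_iff[of c q] 0 by (cases "c \<le> q") auto
next
  case (Suc d)
  then obtain c where "c \<in> Om" "p < c" "steps (Suc (d + e)) c r"
    by (metis add_Suc steps.simps(2))
  then show ?case
    using Suc by (metis steps.simps(2))
qed

lemma F_mono: "\<lbrakk>x \<in> Om; y \<in> Om; x \<le> y\<rbrakk> \<Longrightarrow> F i m x \<le> F i m y"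
  by (meson F_closed adjoint order_refl order_trans)

lemma F_less_iff: "\<lbrakk>x \<in> Om; y \<in> Om\<rbrakk> \<Longrightarrow> F i (m + 1) x < y \<longleftrightarrow> x < F i m y"
  using adjoint[of y x i m] by (simp add: F_closed not_le_iff[symmetric])

text \<open>The trace on an arbitrary chain of the integer identity
  \<open>f\<^sup>r\<^sup>r(x) = f(x + 1) - 1\<close>. It combines the unit
  \<open>c \<le> F i (m + 1) (F i m c)\<close> with the next adjunction.\<close>

lemma F_less:
  assumes "p \<in> Om" "c \<in> Om" "p < c"
  shows "F i (m + 2) p < F i m c"
proof -
  have "c \<le> F i (m + 1) (F i m c)"
    using adjoint assms F_closed by blast
  then have "p < F i (m + 1) (F i m c)"
    using assms by order
  then show ?thesis
    using F_less_iff[of p "F i m c" i "m + 1"] assms F_closed by (simp add: add.assoc)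
qed

text \<open>Follow the sequence from \<open>p\<close>: by \<open>F_less\<close>, each of its
  \<open>e\<close> steps uses up one double residual.\<close>

lemma steps_F:
  "\<lbrakk>steps e p p'; p \<in> Om; p' \<in> Om\<rbrakk> \<Longrightarrow> steps e (F i (m + 2 * int e) p) (F i m p')"
proof (induction e arbitrary: p)
  case (Suc e)
  then obtain c where c: "c \<in> Om" "p < c" "steps e c p'" by auto
  then have "steps e (F i (m + 2 * int e) c) (F i m p')"
    using Suc by blast
  moreover have "F i (m + 2 * int e + 2) p < F i (m + 2 * int e) c"
    using c Suc by (intro F_less)
  ultimately show ?case
    using c F_closed by (force simp: algebra_simps)
qed (auto intro: F_mono)

text \<open>Steps between images are pulled back to steps between arguments. The contrapositive is
  the version of \<open>steps_F\<close> for negative distances.\<close>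

lemma steps_F_cancel:
  "\<lbrakk>steps (Suc e) (F i (m + 2 * int e) p') (F i m p); p \<in> Om; p' \<in> Om\<rbrakk> \<Longrightarrow> steps (Suc e) p' p"
proof (induction e arbitrary: p')
  case 0
  then have "F i m p' < F i m p"
    by auto
  then show ?case
    using 0 F_mono[of p p' i m] not_le_iff[of p p'] by auto
next
  case (Suc e)
  then obtain c where c: "c \<in> Om" "F i (m + 2 * int e + 2) p' < c" "steps (Suc e) c (F i m p)"
    by (auto simp: algebra_simps simp del: steps.simps(2) simp: steps.simps(2)[of "Suc e"])
  \<comment> \<open>The index \<open>m + 2 * int e + 1\<close> is adjacent to both indices in play:
    this map is lower adjoint to the one with index \<open>m + 2 * int e + 2\<close>, giving
    \<open>p' < p''\<close>, and upper adjoint to the one with index \<open>m + 2 * int e\<close>,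
    giving the bound by \<open>c\<close>.\<close>
  define p'' where "p'' = F i (m + 2 * int e + 1) c"
  have p'': "p'' \<in> Om" "p' < p''"
    using c F_less_iff[of p' c i "m + 2 * int e + 1"] Suc F_closed by (auto simp: p''_def add.assoc)
  moreover have "F i (m + 2 * int e) p'' \<le> c"
    unfolding p''_def using adjoint c F_closed by blast
  ultimately have "steps (Suc e) p'' p"
    using Suc c by (blast intro: steps_mono)
  then show ?case
    using p'' by auto
qed

lemma steps_self: "steps e p p \<longleftrightarrow> e = 0"
  by (cases e) (auto dest: steps_le)

lemma finite_chain_greatest:
  assumes "finite D" "D \<noteq> {}" "D \<subseteq> Om"
  obtains m where "m \<in> D" "\<And>x. x \<in> D \<Longrightarrow> x \<le> m"
  using finite_has_maximal[OF assms(1,2)] assms(3) total by (metis subsetD)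

text \<open>Distances in \<open>Om\<close> are truncated at \<open>K\<close>. New points are inserted at the top.\<close>

lemma finite_embedding:
  assumes "finite D" "D \<subseteq> Om" "K > 0"
  shows "\<exists>\<phi>::'x \<Rightarrow> int. (\<forall>p\<in>D. 0 \<le> \<phi> p \<and> \<phi> p \<le> int (card D * K)) \<and>
    (\<forall>p\<in>D. \<forall>q\<in>D. \<forall>e\<le>K. steps e p q \<longleftrightarrow> \<phi> p + int e \<le> \<phi> q)"
  using assms(1,2)
proof (induction "card D" arbitrary: D)
  case 0
  then show ?case by simp
next
  case (Suc N)
  then have "D \<noteq> {}" by auto
  then obtain m where m: "m \<in> D" "\<And>x. x \<in> D \<Longrightarrow> x \<le> m"
    using finite_chain_greatest Suc.prems by blast
  define D' where "D' = D - {m}"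
  have D': "finite D'" "D' \<subseteq> Om" "card D' = N" "D = insert m D'" "m \<notin> D'"
    using m Suc by (auto simp: D'_def)
  obtain \<phi> :: "'x \<Rightarrow> int" where \<phi>: "\<And>p. p \<in> D' \<Longrightarrow> 0 \<le> \<phi> p" "\<And>p. p \<in> D' \<Longrightarrow> \<phi> p \<le> int (N * K)"
    and steps_\<phi>: "\<And>p q e. \<lbrakk>p \<in> D'; q \<in> D'; e \<le> K\<rbrakk> \<Longrightarrow> steps e p q \<longleftrightarrow> \<phi> p + int e \<le> \<phi> q"
    using Suc.hyps(1)[OF D'(3)[symmetric] D'(1,2)] D'(3) by blast
  show ?case
  proof (cases "D' = {}")
    case True
    then show ?thesis
      using D' by (intro exI[of _ "\<lambda>_. 0"]) (auto simp: steps_self)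
  next
    case False
    then obtain p0 where p0: "p0 \<in> D'" "\<And>x. x \<in> D' \<Longrightarrow> x \<le> p0"
      using finite_chain_greatest D' by blast
    have "p0 < m" and [simp]: "p0 \<in> Om" "m \<in> Om" and m': "\<And>x. x \<in> D' \<Longrightarrow> x < m"
      using p0 m Suc.prems D' by (auto simp: order.order_iff_strict)
    \<comment> \<open>The distance, truncated at \<open>K\<close>, from the old top
      \<open>p0\<close> to the new top \<open>m\<close>. Placing \<open>m\<close> exactly
      \<open>g\<close> above \<open>p0\<close> enlarges the range by at most
      \<open>K\<close>.\<close>
    define g where "g = (GREATEST j. j \<le> K \<and> steps j p0 m)"
    have g: "g \<le> K \<and> steps g p0 m"
      unfolding g_def by (rule GreatestI_nat[of _ 0 K]) (use \<open>p0 < m\<close> in auto)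
    have g_max: "j \<le> g" if "j \<le> K" "steps j p0 m" for j
      unfolding g_def by (rule Greatest_le_nat[of _ _ K]) (use that in auto)
    \<comment> \<open>A positive gap puts \<open>m\<close> strictly above all old points, so that
      the order is also reflected.\<close>
    have "steps 1 p0 m"
      using \<open>p0 < m\<close> by auto
    then have "1 \<le> g"
      using g_max[of 1] \<open>K > 0\<close> by simp
    define \<psi> where "\<psi> = \<phi>(m := \<phi> p0 + int g)"
    have \<psi>: "\<psi> m = \<phi> p0 + int g" "\<And>x. x \<in> D' \<Longrightarrow> \<psi> x = \<phi> x"
      using D' by (auto simp: \<psi>_def)
    have le_p0: "\<phi> x \<le> \<phi> p0" if "x \<in> D'" for x
      using steps_\<phi>[OF that p0(1), of 0] p0(2)[OF that] by simp
    have up: "steps e p m \<longleftrightarrow> \<phi> p + int e \<le> \<phi> p0 + int g" if p: "p \<in> D'" and e: "e \<le> K" for p e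
    proof -
      define d where "d = nat (\<phi> p0 - \<phi> p)"
      have d: "\<phi> p0 = \<phi> p + int d"
        using le_p0[OF p] by (simp add: d_def)
      show ?thesis
      proof
        assume *: "steps e p m"
        show "\<phi> p + int e \<le> \<phi> p0 + int g"
        proof (rule ccontr)
          assume "\<not> ?thesis"
          then have less: "d + g < e"
            using d by simp
          \<comment> \<open>Cutting at \<open>p0\<close> contradicts either the exact distance
            \<open>d\<close> from \<open>p\<close> to \<open>p0\<close> or the maximality of
            \<open>g\<close>; both \<open>Suc d\<close> and \<open>Suc g\<close> are still at most
            \<open>K\<close>.\<close>
          then have "steps (Suc (d + g)) p m"
            using * by (auto intro: steps_antimono simp del: steps.simps)
          then have "steps (Suc d) p p0 \<or> steps (Suc g) p0 m"
            by (rule steps_split) simp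
          then show False
            using steps_\<phi>[OF p p0(1), of "Suc d"] g_max[of "Suc g"] less e d by force
        qed
      next
        assume le: "\<phi> p + int e \<le> \<phi> p0 + int g"
        show "steps e p m"
        proof (cases "e \<le> d")
          case True
          then have "steps e p p0"
            using steps_\<phi>[OF p p0(1) e] d by simp
          then show ?thesis
            using \<open>p0 < m\<close> by (meson less_imp_le order_refl steps_mono)
        next
          case False
          then have "steps d p p0"
            using steps_\<phi>[OF p p0(1), of d] d e by simp
          then have "steps (d + g) p m"
            using g by (blast intro: steps_add)
          then show ?thesis
            by (rule steps_antimono) (use le d in simp)
        qed
      qed
    qed
    have down: "\<not> steps e m p" if "p \<in> D'" for p e
      using m'[OF that] steps_le[of e m p] by auto
    show ?thesis
    proof (intro exI[of _ \<psi>] conjI ballI allI impI)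
      fix p q e
      assume "p \<in> D" "q \<in> D" "e \<le> K"
      then consider "p = m" "q = m" | "p \<in> D'" "q = m" | "p = m" "q \<in> D'" | "p \<in> D'" "q \<in> D'"
        using D' by blast
      then show "steps e p q \<longleftrightarrow> \<psi> p + int e \<le> \<psi> q"
      proof cases
        case 3
        then show ?thesis
          using down[of q e] le_p0[of q] \<open>1 \<le> g\<close> by (simp add: \<psi>)
      qed (use up steps_\<phi> \<open>e \<le> K\<close> in \<open>auto simp: \<psi> steps_self\<close>)
    next
      fix p
      assume "p \<in> D"
      then consider "p = m" | "p \<in> D'"
        using D' by blast
      then show "0 \<le> \<psi> p" "\<psi> p \<le> int (card D * K)"
        using \<phi>(1)[of p] \<phi>(2)[of p] \<phi>(1)[OF p0(1)] \<phi>(2)[OF p0(1)] g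
        by (cases; simp add: \<psi> Suc.hyps(2)[symmetric])+
    qed
  qed
qed

end

section \<open>Periodic maps on the integers\<close>

text \<open>For even positive \<open>n\<close> these maps satisfy the defining equation of
  \<open>Fn_Z n\<close>, because even iterated residuals are conjugates by translations.\<close>

definition periodic_mono :: "int \<Rightarrow> (int \<Rightarrow> int) \<Rightarrow> bool" where
  "periodic_mono n g \<longleftrightarrow> mono g \<and> (\<forall>x. g (x + n) = g x + n)"

text \<open>All prescribed arguments and values lie in one period, so a monotone step function on
  that period can be repeated by translation.\<close>

lemma periodic_extension:
  fixes C :: "(int \<times> int) set"
  assumes "finite C" and C: "\<And>x y. (x, y) \<in> C \<Longrightarrow> 0 \<le> x \<and> x < n \<and> 0 \<le> y \<and> y < n"
    and mono: "\<And>x y x' y'. \<lbrakk>(x, y) \<in> C; (x', y') \<in> C; x \<le> x'\<rbrakk> \<Longrightarrow> y \<le> y'"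
    and "n > 0"
  shows "\<exists>g. periodic_mono n g \<and> (\<forall>(x, y)\<in>C. g x = y)"
proof -
  \<comment> \<open>The default value 0 makes the set nonempty and lies below every prescribed
    value.\<close>
  define V where "V x = insert 0 {y. \<exists>x'. (x', y) \<in> C \<and> x' \<le> x}" for x
  define h where "h x = Max (V x)" for x
  have fin: "finite (V x)" for x
  proof (rule finite_subset)
    show "V x \<subseteq> insert 0 (snd ` C)"
      by (force simp: V_def)
  qed (use \<open>finite C\<close> in simp)
  have h_mono: "h x \<le> h x'" if "x \<le> x'" for x x'
    unfolding h_def using that fin by (intro Max_mono) (auto simp: V_def)
  have h_less: "h x < n" for x
    unfolding h_def using fin C \<open>n > 0\<close> by (subst Max_less_iff) (auto simp: V_def)
  have h_ge: "0 \<le> h x" for x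
    unfolding h_def using fin by (intro Max_ge) (auto simp: V_def)
  have h_C: "h x = y" if "(x, y) \<in> C" for x y
    unfolding h_def
  proof (rule Max_eqI)
    show "z \<le> y" if "z \<in> V x" for z
      using that mono C \<open>(x, y) \<in> C\<close> by (auto simp: V_def)
  qed (use fin that in \<open>auto simp: V_def\<close>)
  \<comment> \<open>Values of \<open>h\<close> lie in \<open>[0, n)\<close>, so monotonicity
    survives the passage from one period to the next.\<close>
  define g where "g x = h (x mod n) + n * (x div n)" for x
  have "g x \<le> g x'" if "x \<le> x'" for x x'
  proof (cases "x div n = x' div n")
    case True
    then have "x mod n \<le> x' mod n"
      using that by (simp add: minus_div_mult_eq_mod[symmetric])
    then show ?thesis
      using True h_mono by (simp add: g_def)
  next
    case False
    then have "x div n + 1 \<le> x' div n"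
      using zdiv_mono1[OF that \<open>n > 0\<close>] by simp
    then have "n * (x div n + 1) \<le> n * (x' div n)"
      using \<open>n > 0\<close> by simp
    then show ?thesis
      using h_less[of "x mod n"] h_ge[of "x' mod n"] by (simp add: g_def algebra_simps)
  qed
  moreover have "g (x + n) = g x + n" for x
    using div_add_self2[of n x] \<open>n > 0\<close> by (simp add: g_def distrib_left)
  moreover have "g x = y" if "(x, y) \<in> C" for x y
    using C[OF that] h_C[OF that] by (simp add: g_def)
  ultimately show ?thesis
    by (intro exI[of _ g]) (auto simp: periodic_mono_def mono_def)
qed

section \<open>The l-pregroups of maps on the integers\<close>

definition unbounded_mono :: "(int \<Rightarrow> int) \<Rightarrow> bool" where
  "unbounded_mono f \<longleftrightarrow> mono f \<and> (\<forall>b. (\<exists>a. f a \<le> b) \<and> (\<exists>a. b < f a))"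

text \<open>For a monotone map unbounded on both sides, each set \<open>{a. f a \<le> b}\<close> is
  a proper nonempty initial segment of the integers and so has a greatest element.\<close>

lemma has_residual_iff: "has_residual f \<longleftrightarrow> unbounded_mono f"
proof
  assume "has_residual f"
  then obtain g where g: "\<And>a b. f a \<le> b \<longleftrightarrow> a \<le> g b"
    unfolding has_residual_def by blast
  have "mono f"
    by (meson g monoI order_refl order_trans)
  moreover have "f (g b) \<le> b" "b < f (g b + 1)" for b
    using g[of "g b" b] g[of "g b + 1" b] by simp_all
  ultimately show "unbounded_mono f"
    unfolding unbounded_mono_def by blast
next
  assume f: "unbounded_mono f"
  have "\<exists>c. \<forall>a. f a \<le> b \<longleftrightarrow> a \<le> c" for b
  proof -
    obtain a0 a1 where a: "b < f a0" "f a1 \<le> b"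
      using f unfolding unbounded_mono_def by blast
    then have "a1 < a0"
      using f unfolding unbounded_mono_def mono_def by (meson leI not_le order_trans)
    then have "f (a0 - int (nat (a0 - a1))) \<le> b"
      using a by simp
    \<comment> \<open>Descending from \<open>a0\<close>, where \<open>f\<close> exceeds
      \<open>b\<close>, the first point with value at most \<open>b\<close> is the greatest such
      point.\<close>
    define k where "k = (LEAST k. f (a0 - int k) \<le> b)"
    have k: "f (a0 - int k) \<le> b"
      unfolding k_def by (rule LeastI) fact
    have "k \<noteq> 0"
    proof
      assume "k = 0"
      with k a show False by simp
    qed
    then have "\<not> f (a0 - int (k - 1)) \<le> b"
      unfolding k_def by (intro not_less_Least) simp
    then have "\<not> f (a0 - int k + 1) \<le> b"
      using \<open>k \<noteq> 0\<close> by (simp add: of_nat_diff algebra_simps)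
    then have "f a \<le> b \<longleftrightarrow> a \<le> a0 - int k" for a
      using f k unfolding unbounded_mono_def mono_def by (meson not_le order_trans zless_imp_add1_zle)
    then show ?thesis
      by blast
  qed
  then show "has_residual f"
    unfolding has_residual_def by metis
qed

text \<open>On the integers \<open>f a \<le> b\<close> is the negation of
  \<open>b + 1 \<le> f a\<close>, so residual and dual residual determine each other up to shifts by
  one.\<close>

lemma has_dual_residual_iff: "has_dual_residual f \<longleftrightarrow> unbounded_mono f"
proof -
  have "has_dual_residual f" if "has_residual f"
  proof -
    have "a \<le> f b \<longleftrightarrow> residual f (a - 1) + 1 \<le> b" for a b
      using residual_galois[OF that, of b "a - 1"] by linarith
    then show ?thesis
      unfolding has_dual_residual_def by (intro exI[of _ "\<lambda>a. residual f (a - 1) + 1"]) blast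
  qed
  moreover have "has_residual f" if "has_dual_residual f"
  proof -
    have "f a \<le> b \<longleftrightarrow> a \<le> dual_residual f (b + 1) - 1" for a b
      using dual_residual_galois[OF that, of "b + 1" a] by linarith
    then show ?thesis
      unfolding has_residual_def by (intro exI[of _ "\<lambda>b. dual_residual f (b + 1) - 1"]) blast
  qed
  ultimately show ?thesis
    using has_residual_iff by blast
qed

lemmas residual_le_iff = residual_galois[unfolded has_residual_iff]
lemmas dual_residual_le_iff = dual_residual_galois[unfolded has_dual_residual_iff]

lemma unbounded_mono_residual: "unbounded_mono f \<Longrightarrow> unbounded_mono (residual f)"
  using residual_le_iff[of f] unfolding has_dual_residual_iff[symmetric] has_dual_residual_def by blast

lemma unbounded_mono_dual_residual: "unbounded_mono f \<Longrightarrow> unbounded_mono (dual_residual f)"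
  using dual_residual_le_iff[of f] unfolding has_residual_iff[symmetric] has_residual_def by blast

text \<open>The residual of \<open>f\<close> has \<open>f\<close> as its dual residual, and vice
  versa, so monotonicity and unboundedness pass to residuals of every order.\<close>

lemma carrier_F_Z: "carrier F_Z = {f. unbounded_mono f}"
proof -
  have "unbounded_mono ((residual ^^ k) f)" "unbounded_mono ((dual_residual ^^ k) f)"
    if "unbounded_mono f" for k f
    by (induction k; simp add: that unbounded_mono_residual unbounded_mono_dual_residual)+
  then show ?thesis
    unfolding F_Z_def has_residual_iff has_dual_residual_iff by auto (metis funpow_0)
qed

section \<open>\<open>F_Z\<close> as a distributive l-pregroup\<close>

lemma F_Z_simps [simp]:
  "mult F_Z = (\<circ>)" "one F_Z = id" "lp_meet F_Z f g = (\<lambda>x. min (f x) (g x))"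
  "lp_join F_Z f g = (\<lambda>x. max (f x) (g x))" "lp_l F_Z = dual_residual" "lp_r F_Z = residual"
  by (simp_all add: F_Z_def)

lemma F_Z_le_iff: "lp_le F_Z f g \<longleftrightarrow> (\<forall>x. f x \<le> g x)"
  by (auto simp: lp_le_def fun_eq_iff min_def)

lemma distributive_lpregroup_F_Z: "distributive_lpregroup F_Z"
proof unfold_locales
  fix f g assume f: "f \<in> carrier F_Z" and g: "g \<in> carrier F_Z"
  then have mono: "mono f" "mono g"
    and low: "\<And>b. \<exists>a. f a \<le> b" "\<And>b. \<exists>a. g a \<le> b" and high: "\<And>b. \<exists>a. b < f a" "\<And>b. \<exists>a. b < g a"
    by (auto simp: carrier_F_Z unbounded_mono_def)
  have low': "\<exists>a. f a \<le> b \<and> g a \<le> b" for b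
  proof -
    obtain a a' where "f a \<le> b" "g a' \<le> b" using low by blast
    then show ?thesis
      using monoD[OF mono(1), of "min a a'" a] monoD[OF mono(2), of "min a a'" a']
      by (intro exI[of _ "min a a'"]) auto
  qed
  have high': "\<exists>a. b < f a \<and> b < g a" for b
  proof -
    obtain a a' where "b < f a" "b < g a'" using high by blast
    then show ?thesis
      using monoD[OF mono(1), of a "max a a'"] monoD[OF mono(2), of a' "max a a'"]
      by (intro exI[of _ "max a a'"]) auto
  qed
  show "f \<otimes>\<^bsub>F_Z\<^esub> g \<in> carrier F_Z"
  proof -
    have "\<exists>a. f (g a) \<le> b" "\<exists>a. b < f (g a)" for b
      using low high mono by (meson monoD order_trans less_le_trans less_imp_le)+
    then show ?thesis
      using mono by (simp add: carrier_F_Z unbounded_mono_def mono_def)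
  qed
  have "mono (\<lambda>x. min (f x) (g x))" "mono (\<lambda>x. max (f x) (g x))"
    by (intro monoI min.mono max.mono monoD[OF mono(1)] monoD[OF mono(2)]; simp)+
  moreover have "\<exists>a. min (f a) (g a) \<le> b" "\<exists>a. max (f a) (g a) \<le> b"
    "\<exists>a. b < min (f a) (g a)" "\<exists>a. b < max (f a) (g a)" for b
    using low'[of b] high'[of b] by (auto simp: min_le_iff_disj less_max_iff_disj)
  ultimately show "f \<^bold>\<and>\<^bsub>F_Z\<^esub> g \<in> carrier F_Z" "f \<^bold>\<or>\<^bsub>F_Z\<^esub> g \<in> carrier F_Z"
    unfolding carrier_F_Z unbounded_mono_def F_Z_simps by blast+
  show "f \<^bold>\<and>\<^bsub>F_Z\<^esub> g = g \<^bold>\<and>\<^bsub>F_Z\<^esub> f" "f \<^bold>\<or>\<^bsub>F_Z\<^esub> g = g \<^bold>\<or>\<^bsub>F_Z\<^esub> f"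
    "f \<^bold>\<and>\<^bsub>F_Z\<^esub> (f \<^bold>\<or>\<^bsub>F_Z\<^esub> g) = f" "f \<^bold>\<or>\<^bsub>F_Z\<^esub> (f \<^bold>\<and>\<^bsub>F_Z\<^esub> g) = f"
    by (auto simp: fun_eq_iff min_def max_def)
next
  show "\<one>\<^bsub>F_Z\<^esub> \<in> carrier F_Z"
    by (auto simp: carrier_F_Z unbounded_mono_def mono_def intro: exI[of _ "_ + 1"])
next
  fix f assume "f \<in> carrier F_Z"
  then have f: "unbounded_mono f" by (simp add: carrier_F_Z)
  show "\<l>\<^bsub>F_Z\<^esub> f \<in> carrier F_Z" "\<r>\<^bsub>F_Z\<^esub> f \<in> carrier F_Z"
    using f by (simp_all add: carrier_F_Z unbounded_mono_residual unbounded_mono_dual_residual)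
  show "\<l>\<^bsub>F_Z\<^esub> f \<otimes>\<^bsub>F_Z\<^esub> f \<^bold>\<le>\<^bsub>F_Z\<^esub> \<one>\<^bsub>F_Z\<^esub>" "\<one>\<^bsub>F_Z\<^esub> \<^bold>\<le>\<^bsub>F_Z\<^esub> f \<otimes>\<^bsub>F_Z\<^esub> \<l>\<^bsub>F_Z\<^esub> f"
    using dual_residual_le_iff[OF f, of "f x" x for x]
      dual_residual_le_iff[OF f, of x "dual_residual f x" for x]
    by (simp_all add: F_Z_le_iff)
  show "f \<otimes>\<^bsub>F_Z\<^esub> \<r>\<^bsub>F_Z\<^esub> f \<^bold>\<le>\<^bsub>F_Z\<^esub> \<one>\<^bsub>F_Z\<^esub>" "\<one>\<^bsub>F_Z\<^esub> \<^bold>\<le>\<^bsub>F_Z\<^esub> \<r>\<^bsub>F_Z\<^esub> f \<otimes>\<^bsub>F_Z\<^esub> f"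
    using residual_le_iff[OF f, of x "f x" for x] residual_le_iff[OF f, of "residual f x" x for x]
    by (simp_all add: F_Z_le_iff)
next
  fix f g h :: "int \<Rightarrow> int"
  assume "f \<in> carrier F_Z" "g \<in> carrier F_Z" "h \<in> carrier F_Z"
  then have "mono h"
    by (simp add: carrier_F_Z unbounded_mono_def)
  then show "f \<^bold>\<le>\<^bsub>F_Z\<^esub> g \<Longrightarrow> h \<otimes>\<^bsub>F_Z\<^esub> f \<^bold>\<le>\<^bsub>F_Z\<^esub> h \<otimes>\<^bsub>F_Z\<^esub> g"
    by (simp add: F_Z_le_iff mono_def)
qed (auto simp: F_Z_le_iff fun_eq_iff min_def max_def)

section \<open>Iterated residuals on the integers\<close>

interpretation F_Z: distributive_lpregroup F_Z
  by (rule distributive_lpregroup_F_Z)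

text \<open>By adjointness \<open>y \<le> f\<^sup>r\<^sup>r(x)\<close> means
  \<open>f\<^sup>r(y) < x + 1\<close>, which means \<open>y < f(x + 1)\<close>.\<close>

lemma residual_residual:
  assumes "unbounded_mono f"
  shows "residual (residual f) x = f (x + 1) - 1"
proof -
  have "y \<le> residual (residual f) x \<longleftrightarrow> y \<le> f (x + 1) - 1" for y
    using residual_le_iff[OF unbounded_mono_residual[OF assms], of y x]
      residual_le_iff[OF assms, of "x + 1" y] by linarith
  then show ?thesis
    by (meson order.antisym order_refl)
qed

lemma res_pow_even:
  assumes f: "unbounded_mono f"
  shows "res_pow F_Z (2 * k) f x = f (x + k) - k"
proof (induction k arbitrary: x rule: int_induct[where k = 0])
  case base
  then show ?case by simp
next
  note [simp] = carrier_F_Z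
  case (step1 i)
  let ?g = "res_pow F_Z (2 * i) f"
  have "res_pow F_Z (2 * (i + 1)) f = residual (residual ?g)"
    using F_Z.r_res_pow[of f "2 * i"] F_Z.r_res_pow[of f "2 * i + 1"] f by (simp add: algebra_simps)
  then have "res_pow F_Z (2 * (i + 1)) f x = ?g (x + 1) - 1"
    using residual_residual[of ?g x] F_Z.res_pow_closed[of f "2 * i"] f by simp
  then show ?case
    using step1.IH[of "x + 1"] by (simp add: ac_simps)
next
  note [simp] = carrier_F_Z
  case (step2 i)
  let ?g = "res_pow F_Z (2 * (i - 1)) f"
  \<comment> \<open>Going down, the map with known formula is the double residual of
    \<open>?g\<close>; its value at \<open>x - 1\<close> reveals \<open>?g x\<close>.\<close>
  have "res_pow F_Z (2 * i) f = residual (residual ?g)"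
    using F_Z.r_res_pow[of f "2 * i - 2"] F_Z.r_res_pow[of f "2 * i - 1"] f by (simp add: algebra_simps)
  then have "res_pow F_Z (2 * i) f (x - 1) = ?g x - 1"
    using residual_residual[of ?g "x - 1"] F_Z.res_pow_closed[of f "2 * (i - 1)"] f by simp
  then show ?case
    using step2.IH[of "x - 1"] by (simp add: algebra_simps)
qed

text \<open>The odd case in terms of the even neighbours, which avoids maxima and minima.\<close>

lemma res_pow_odd_eqI:
  assumes f: "unbounded_mono f" and "f (y + k) \<le> x + k" "x + k < f (y + k + 1)"
  shows "res_pow F_Z (2 * k + 1) f x = y"
proof -
  let ?g = "res_pow F_Z (2 * k) f"
  have g: "unbounded_mono ?g"
    using F_Z.res_pow_closed[of f "2 * k"] f by (simp add: carrier_F_Z)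
  have "res_pow F_Z (2 * k + 1) f = residual ?g"
    using F_Z.r_res_pow[of f "2 * k"] f by (simp add: carrier_F_Z)
  moreover have "?g y = f (y + k) - k" "?g (y + 1) = f (y + k + 1) - k"
    using res_pow_even[OF f, of k y] res_pow_even[OF f, of k "y + 1"] by (simp_all add: ac_simps)
  moreover have "?g y \<le> x" "\<not> ?g (y + 1) \<le> x"
    using assms(2,3) calculation by linarith+
  ultimately show ?thesis
    using residual_le_iff[OF g, of y x] residual_le_iff[OF g, of "y + 1" x] by simp
qed

section \<open>The algebras \<open>Fn_Z n\<close> and their periodic members\<close>

lemma periodic_mono_unbounded:
  assumes "periodic_mono n g" "n > 0"
  shows "unbounded_mono g"
proof -
  have plus: "g (x + n * int k) = g x + n * int k" for x k
  proof (induction k)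
    case (Suc k)
    have "g (x + n * int k + n) = g (x + n * int k) + n"
      using assms(1) by (simp add: periodic_mono_def)
    then show ?case
      using Suc by (simp add: algebra_simps)
  qed simp
  have minus: "g (x - n * int k) = g x - n * int k" for x k
    using plus[of "x - n * int k" k] by simp
  have "\<exists>a. g a \<le> b" "\<exists>a. b < g a" for b
  proof -
    define k where "k = nat (\<bar>g 0\<bar> + \<bar>b\<bar> + 1)"
    have "int k \<le> n * int k"
      using \<open>n > 0\<close> by (simp add: mult_le_cancel_right1)
    moreover have "int k = \<bar>g 0\<bar> + \<bar>b\<bar> + 1"
      by (simp add: k_def)
    ultimately have "g (0 - n * int k) \<le> b" "b < g (0 + n * int k)"
      unfolding plus minus by linarith+
    then show "\<exists>a. g a \<le> b" "\<exists>a. b < g a"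
      by blast+
  qed
  then show ?thesis
    using assms(1) by (simp add: unbounded_mono_def periodic_mono_def)
qed

lemma carrier_Fn_Z: "carrier (Fn_Z n) = {f \<in> carrier F_Z. res_pow F_Z (- int n) f = res_pow F_Z (int n) f}"
  by (auto simp: Fn_Z_def res_pow_def)

lemma Fn_Z_simps [simp]:
  "mult (Fn_Z n) = (\<circ>)" "one (Fn_Z n) = id" "lp_meet (Fn_Z n) = lp_meet F_Z"
  "lp_join (Fn_Z n) = lp_join F_Z" "lp_l (Fn_Z n) = dual_residual" "lp_r (Fn_Z n) = residual"
  by (simp_all add: Fn_Z_def)

lemma eval_term_Fn_Z: "eval_term (Fn_Z n) v t = eval_term F_Z v t"
  by (induction t) simp_all

text \<open>For \<open>n = 2 * j\<close> the two sides of the defining equation are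
  \<open>g (x - j) + j\<close> and \<open>g (x + j) - j\<close>, which differ by one application of
  periodicity.\<close>

lemma periodic_mono_in_Fn_Z:
  assumes "periodic_mono (int n) g" "n > 0" "even n"
  shows "g \<in> carrier (Fn_Z n)"
proof -
  obtain j where n: "n = 2 * j" using \<open>even n\<close> by blast
  have g: "unbounded_mono g"
    using periodic_mono_unbounded assms by simp
  have "g (x + int j) = g (x - int j) + int n" for x
    using assms(1) n unfolding periodic_mono_def
    by (metis add_diff_cancel add_diff_eq diff_add_cancel mult_2 of_nat_add)
  then have "res_pow F_Z (- int n) g x = res_pow F_Z (int n) g x" for x
    using res_pow_even[OF g, of "int j" x] res_pow_even[OF g, of "- int j" x] n by simp
  then show ?thesis
    using g by (auto simp: carrier_Fn_Z carrier_F_Z)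
qed

text \<open>The formulas for iterated residuals of products, meets and joins depend only on parity,
  and \<open>n\<close> and \<open>- n\<close> have the same parity; hence the carrier is closed
  under the operations of \<open>F_Z\<close>.\<close>

lemma distributive_lpregroup_Fn_Z: "distributive_lpregroup (Fn_Z n)"
proof -
  have sub: "f \<in> carrier F_Z" if "f \<in> carrier (Fn_Z n)" for f
    using that by (simp add: carrier_Fn_Z)
  have le: "lp_le (Fn_Z n) f g \<longleftrightarrow> lp_le F_Z f g" for f g
    by (simp add: lp_le_def)
  have r: "residual f \<in> carrier (Fn_Z n)" and l: "dual_residual f \<in> carrier (Fn_Z n)"
    if "f \<in> carrier (Fn_Z n)" for f
  proof -
    note f = sub[OF that]
    have eq: "res_pow F_Z (- int n) f = res_pow F_Z (int n) f"
      using that by (simp add: carrier_Fn_Z)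
    have "res_pow F_Z (- int n + 1) f = res_pow F_Z (int n + 1) f"
      "res_pow F_Z (- int n - 1) f = res_pow F_Z (int n - 1) f"
      using eq F_Z.r_res_pow[OF f] F_Z.l_res_pow[OF f] by metis+
    then show "residual f \<in> carrier (Fn_Z n)" "dual_residual f \<in> carrier (Fn_Z n)"
      using F_Z.r_closed[OF f] F_Z.res_pow_r[OF f] F_Z.l_closed[OF f] F_Z.res_pow_l[OF f]
      by (simp_all add: carrier_Fn_Z)
  qed
  show ?thesis
  proof unfold_locales
    fix f g assume f: "f \<in> carrier (Fn_Z n)" and g: "g \<in> carrier (Fn_Z n)"
    show "f \<otimes>\<^bsub>Fn_Z n\<^esub> g \<in> carrier (Fn_Z n)"
      using f g F_Z.res_pow_mult[of f g] F_Z.m_closed[of f g] by (simp add: carrier_Fn_Z)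
    show "f \<^bold>\<and>\<^bsub>Fn_Z n\<^esub> g \<in> carrier (Fn_Z n)"
      using f g F_Z.res_pow_meet[of f g] F_Z.meet_closed[of f g] by (simp add: carrier_Fn_Z)
    show "f \<^bold>\<or>\<^bsub>Fn_Z n\<^esub> g \<in> carrier (Fn_Z n)"
      using f g F_Z.res_pow_join[of f g] F_Z.join_closed[of f g] by (simp add: carrier_Fn_Z)
  next
    show "\<one>\<^bsub>Fn_Z n\<^esub> \<in> carrier (Fn_Z n)"
      using F_Z.res_pow_one F_Z.one_closed by (simp add: carrier_Fn_Z)
  next
    fix f assume f: "f \<in> carrier (Fn_Z n)"
    show "\<l>\<^bsub>Fn_Z n\<^esub> f \<otimes>\<^bsub>Fn_Z n\<^esub> f \<^bold>\<le>\<^bsub>Fn_Z n\<^esub> \<one>\<^bsub>Fn_Z n\<^esub>"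
      using F_Z.l_mult_le_one[OF sub[OF f]] by (simp add: le)
    show "\<one>\<^bsub>Fn_Z n\<^esub> \<^bold>\<le>\<^bsub>Fn_Z n\<^esub> f \<otimes>\<^bsub>Fn_Z n\<^esub> \<l>\<^bsub>Fn_Z n\<^esub> f"
      using F_Z.one_le_mult_l[OF sub[OF f]] by (simp add: le)
    show "f \<otimes>\<^bsub>Fn_Z n\<^esub> \<r>\<^bsub>Fn_Z n\<^esub> f \<^bold>\<le>\<^bsub>Fn_Z n\<^esub> \<one>\<^bsub>Fn_Z n\<^esub>"
      using F_Z.mult_r_le_one[OF sub[OF f]] by (simp add: le)
    show "\<one>\<^bsub>Fn_Z n\<^esub> \<^bold>\<le>\<^bsub>Fn_Z n\<^esub> \<r>\<^bsub>Fn_Z n\<^esub> f \<otimes>\<^bsub>Fn_Z n\<^esub> f"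
      using F_Z.one_le_r_mult[OF sub[OF f]] by (simp add: le)
  next
    fix f g h assume fgh: "f \<in> carrier (Fn_Z n)" "g \<in> carrier (Fn_Z n)" "h \<in> carrier (Fn_Z n)"
    show "f \<^bold>\<le>\<^bsub>Fn_Z n\<^esub> g \<Longrightarrow> f \<otimes>\<^bsub>Fn_Z n\<^esub> h \<^bold>\<le>\<^bsub>Fn_Z n\<^esub> g \<otimes>\<^bsub>Fn_Z n\<^esub> h"
      using F_Z.mult_mono_left[of f g h] fgh sub by (simp add: le)
    show "f \<^bold>\<le>\<^bsub>Fn_Z n\<^esub> g \<Longrightarrow> h \<otimes>\<^bsub>Fn_Z n\<^esub> f \<^bold>\<le>\<^bsub>Fn_Z n\<^esub> h \<otimes>\<^bsub>Fn_Z n\<^esub> g"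
      using F_Z.mult_mono_right[of f g h] fgh sub by (simp add: le)
  qed (auto simp: fun_eq_iff min_def max_def intro: r l)
qed

section \<open>Realizing finitely many values by periodic maps\<close>

context residuated_family
begin

text \<open>If \<open>\<phi>\<close> preserves small distances, then \<open>g (\<phi> p + k) = \<phi> (F i (2 k) p) + k\<close>, the identity
  that the residual powers of a map \<open>g\<close> on the integers satisfy, prescribes a monotone partial map.\<close>

lemma shifted_mono:
  assumes "\<And>p q e. \<lbrakk>p \<in> D; q \<in> D; e \<le> K\<rbrakk> \<Longrightarrow> steps e p q \<longleftrightarrow> \<phi> p + int e \<le> \<phi> q"
    and "p \<in> D" "p' \<in> D" "F i (2 * k) p \<in> D" "F i (2 * k') p' \<in> D" "D \<subseteq> Om"
    and "\<bar>k - k'\<bar> < int K" and "\<phi> p + k \<le> \<phi> p' + k'"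
  shows "\<phi> (F i (2 * k) p) + k \<le> \<phi> (F i (2 * k') p') + k'"
proof (cases "k' \<le> k")
  case True
  \<comment> \<open>Here the hypothesis says that \<open>p + e\<close> is at most \<open>p'\<close>,
    the situation of \<open>steps_F\<close>.\<close>
  define e where "e = nat (k - k')"
  have e: "k = k' + int e" "e \<le> K"
    using True assms(7) by (simp_all add: e_def)
  then have "steps e p p'"
    using assms by simp
  then have "steps e (F i (2 * k) p) (F i (2 * k') p')"
    using steps_F[of e p p' i "2 * k'"] e assms by (auto simp: algebra_simps)
  then show ?thesis
    using assms e by simp
next
  case False
  define e where "e = nat (k' - k)"
  have e: "k' = k + int e" "Suc e \<le> K"
    using False assms(7) by (simp_all add: e_def)
  show ?thesis
  proof (rule ccontr)
    assume "\<not> ?thesis"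
    \<comment> \<open>Negating an integer inequality adds one step; the strict bound on
      \<open>\<bar>k - k'\<bar>\<close> keeps \<open>Suc e\<close> within the truncation.\<close>
    then have "\<phi> (F i (2 * k') p') + int (Suc e) \<le> \<phi> (F i (2 * k) p)"
      using e by simp
    then have "steps (Suc e) (F i (2 * k') p') (F i (2 * k) p)"
      using assms e by blast
    then have "steps (Suc e) (F i (2 * k + 2 * int e) p') (F i (2 * k) p)"
      using e by (simp only: distrib_left)
    then have "steps (Suc e) p' p"
      using steps_F_cancel assms by blast
    then show False
      using assms(1)[of p' p "Suc e"] assms e by simp
  qed
qed

text \<open>There are at most \<open>4 * N + 1\<close> relevant points. With distances truncated at
  \<open>B + 2\<close> and a margin for shifts at both ends, all prescribed data fit into one period
  of length \<open>n\<close>.\<close>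

lemma realize_literals:
  assumes "finite S" "card S \<le> N" "x0 \<in> Om"
    and S: "\<And>i m x. (i, m, x) \<in> S \<Longrightarrow> x \<in> Om \<and> \<bar>m\<bar> \<le> int B"
    and n: "int ((4 * N + 1) * (B + 2) + 2 * B + 3) \<le> n"
  obtains D and \<phi> :: "'x \<Rightarrow> int" and g where
    "x0 \<in> D" "D \<subseteq> Om" "\<And>p q. \<lbrakk>p \<in> D; q \<in> D\<rbrakk> \<Longrightarrow> p \<le> q \<longleftrightarrow> \<phi> p \<le> \<phi> q"
    "\<And>i. periodic_mono n (g i)"
    "\<And>i m x. (i, m, x) \<in> S \<Longrightarrow> F i m x \<in> D \<and> \<phi> (F i m x) = res_pow F_Z m (g i) (\<phi> x)"
proof -
  \<comment> \<open>The two neighbouring residuals of the value are included because they sandwich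
    the argument of a literal of odd order.\<close>
  define pts where "pts = (\<lambda>(i, m, x).
    {x, F i m x, F i (m - 1) (F i m x), F i (m + 1) (F i m x)})"
  define D where "D = insert x0 (\<Union>(pts ` S))"
  \<comment> \<open>Shifts \<open>k\<close> and \<open>k'\<close> with
    \<open>\<bar>2 * k\<bar>\<close> and \<open>\<bar>2 * k'\<bar>\<close> at most
    \<open>B + 1\<close> differ by at most \<open>B + 1\<close>, which is less than
    \<open>K\<close>.\<close>
  define K where "K = B + 2"
  have "card (pts s) \<le> 4" for s
    by (auto simp: pts_def card_insert_if split: prod.split)
  then have "(\<Sum>s\<in>S. card (pts s)) \<le> 4 * card S"
    using sum_bounded_above[of S "\<lambda>s. card (pts s)" 4] by (simp add: mult.commute)
  then have "card (\<Union>(pts ` S)) \<le> 4 * N"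
    using card_UN_le[OF \<open>finite S\<close>, of pts] \<open>card S \<le> N\<close> by linarith
  then have card_D: "card D \<le> 4 * N + 1"
    using card_insert_le_m1[of "4 * N + 1" "\<Union>(pts ` S)" x0] by (simp add: D_def)
  have "finite D"
    using \<open>finite S\<close> by (auto simp: D_def pts_def)
  have "D \<subseteq> Om"
    using S assms(3) by (auto simp: D_def pts_def intro!: F_closed)
  have "K > 0"
    by (simp add: K_def)
  then obtain \<phi>0 :: "'x \<Rightarrow> int" where \<phi>0: "\<And>p. p \<in> D \<Longrightarrow> 0 \<le> \<phi>0 p \<and> \<phi>0 p \<le> int (card D * K)"
    and steps_\<phi>0: "\<And>p q e. \<lbrakk>p \<in> D; q \<in> D; e \<le> K\<rbrakk> \<Longrightarrow> steps e p q \<longleftrightarrow> \<phi>0 p + int e \<le> \<phi>0 q"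
    using finite_embedding[OF \<open>finite D\<close> \<open>D \<subseteq> Om\<close>, of K] by blast
  \<comment> \<open>The translation keeps the arguments and values nonnegative under the shifts that
    follow.\<close>
  define \<phi> where "\<phi> p = \<phi>0 p + int B + 1" for p
  have steps_\<phi>: "steps e p q \<longleftrightarrow> \<phi> p + int e \<le> \<phi> q" if "p \<in> D" "q \<in> D" "e \<le> K" for p q e
    using steps_\<phi>0[OF that] by (simp add: \<phi>_def)
  have \<phi>: "int B + 1 \<le> \<phi> p \<and> \<phi> p + int B + 1 < n" if "p \<in> D" for p
  proof -
    have "card D * K \<le> (4 * N + 1) * (B + 2)"
      unfolding K_def using card_D by (intro mult_mono) auto
    then have "int (card D * K) + int (2 * B + 3) \<le> n"
      using n by linarith
    then show ?thesis
      using \<phi>0[OF that] by (simp add: \<phi>_def)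
  qed
  \<comment> \<open>The bound is \<open>B + 1\<close> rather than \<open>B\<close>: an odd order
    \<open>m\<close> refers to the even orders \<open>m - 1\<close> and
    \<open>m + 1\<close>.\<close>
  define E where "E i = {(k, p). p \<in> D \<and> F i (2 * k) p \<in> D \<and> \<bar>2 * k\<bar> \<le> int B + 1}" for i
  define C where "C i = (\<lambda>(k, p). (\<phi> p + k, \<phi> (F i (2 * k) p) + k)) ` E i" for i
  have "\<exists>g. periodic_mono n g \<and> (\<forall>(x, y)\<in>C i. g x = y)" for i
  proof (rule periodic_extension)
    have "E i \<subseteq> {- (int B + 1)..int B + 1} \<times> D"
      by (auto simp: E_def)
    then show "finite (C i)"
      unfolding C_def using \<open>finite D\<close>
      by (meson finite_SigmaI finite_atLeastAtMost_int finite_imageI finite_subset)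
    show "0 \<le> x \<and> x < n \<and> 0 \<le> y \<and> y < n" if "(x, y) \<in> C i" for x y
      using that by (auto simp: C_def E_def dest!: \<phi>)
    show "y \<le> y'" if xy: "(x, y) \<in> C i" "(x', y') \<in> C i" "x \<le> x'" for x y x' y'
    proof -
      obtain k p k' p' where *: "(k, p) \<in> E i" "(k', p') \<in> E i"
        "x = \<phi> p + k" "y = \<phi> (F i (2 * k) p) + k" "x' = \<phi> p' + k'" "y' = \<phi> (F i (2 * k') p') + k'"
        using xy(1,2) by (auto simp: C_def)
      then show ?thesis
        using xy(3) \<open>D \<subseteq> Om\<close> unfolding *(3-6)
        by (intro shifted_mono[of D K \<phi>, OF steps_\<phi>]) (auto simp: E_def K_def)
    qed
    show "n > 0"
      using n by linarith
  qed
  then obtain g where g: "\<And>i. periodic_mono n (g i)" "\<And>i x y. (x, y) \<in> C i \<Longrightarrow> g i x = y"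
    by (metis (mono_tags, lifting) case_prodD)
  have g_E: "g i (\<phi> p + k) = \<phi> (F i (2 * k) p) + k"
    if "p \<in> D" "F i (2 * k) p \<in> D" "\<bar>2 * k\<bar> \<le> int B + 1" for i k p
    using that by (intro g) (force simp: C_def E_def)
  have g_unbounded: "unbounded_mono (g i)" for i
    using periodic_mono_unbounded[OF g(1)] n by simp
  have \<phi>_mono: "p \<le> q \<longleftrightarrow> \<phi> p \<le> \<phi> q" if "p \<in> D" "q \<in> D" for p q
    using steps_\<phi>[OF that, of 0] by simp
  show ?thesis
  proof
    show "x0 \<in> D"
      by (simp add: D_def)
    fix i m x
    assume imx: "(i, m, x) \<in> S"
    define y where "y = F i m x"
    have D: "x \<in> D" "y \<in> D" "F i (m - 1) y \<in> D" "F i (m + 1) y \<in> D"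
      using imx by (auto simp: D_def pts_def y_def intro: bexI[of _ "(i, m, x)"])
    have m: "\<bar>m\<bar> \<le> int B"
      using S[OF imx] by simp
    have "\<phi> y = res_pow F_Z m (g i) (\<phi> x)"
    proof (cases "even m")
      case True
      then obtain k where k: "m = 2 * k" by blast
      then show ?thesis
        using g_E[of x i k] D m by (simp add: y_def res_pow_even[OF g_unbounded])
    next
      case False
      then obtain k where k: "m = 2 * k + 1" by (blast elim: oddE)
      have Om: "x \<in> Om" "y \<in> Om"
        using D \<open>D \<subseteq> Om\<close> by auto
      \<comment> \<open>After embedding, this becomes
        \<open>g(\<phi> y + k) \<le> \<phi> x + k < g(\<phi> y + k + 1)\<close>, the criterion for
        the value of an odd residual.\<close>
      have "F i (2 * k) y \<le> x" "x \<le> F i (2 * (k + 1)) y"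
        using adjoint[of y x i "2 * k"] adjoint[of x y i "2 * k + 1"] Om
        by (simp_all add: y_def k add.assoc)
      then have "\<phi> (F i (2 * k) y) \<le> \<phi> x" "\<phi> x \<le> \<phi> (F i (2 * (k + 1)) y)"
        using \<phi>_mono D by (simp_all add: k algebra_simps)
      moreover have "g i (\<phi> y + k) = \<phi> (F i (2 * k) y) + k"
        using D m k by (intro g_E) auto
      moreover have "g i (\<phi> y + (k + 1)) = \<phi> (F i (2 * (k + 1)) y) + (k + 1)"
        using D m k by (intro g_E) (auto simp: algebra_simps)
      ultimately have "res_pow F_Z (2 * k + 1) (g i) (\<phi> x) = \<phi> y"
        by (intro res_pow_odd_eqI[OF g_unbounded]) (simp_all add: add.assoc)
      then show ?thesis
        by (simp add: k)
    qed
    then show "F i m x \<in> D \<and> \<phi> (F i m x) = res_pow F_Z m (g i) (\<phi> x)"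
      using D by (simp add: y_def)
  qed (use g \<open>D \<subseteq> Om\<close> \<phi>_mono in auto)
qed

end

text \<open>A literal is applied to the starting point or to the value of a subterm, and such values
  stay in a chain closed under \<open>F\<close>.\<close>

lemma literals_mem:
  assumes "\<And>i m x. x \<in> X \<Longrightarrow> F i m x \<in> X"
    and "\<And>x y. \<lbrakk>x \<in> X; y \<in> X\<rbrakk> \<Longrightarrow> x \<le> y \<or> y \<le> x"
    and "x \<in> X" "(i, k, y) \<in> literals F t m x"
  shows "y \<in> X"
  using assms(3,4)
proof (induction t arbitrary: m x)
  have mem: "term_map F t m x \<in> X" if "x \<in> X" for t m x
    using that
  proof (induction t arbitrary: m x)
    case (Meet s t)
    show ?case
      using Meet.IH(1)[OF Meet.prems, of m] Meet.IH(2)[OF Meet.prems, of m]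
        assms(2)[of "term_map F s m x" "term_map F t m x"]
      by (auto simp: inf_absorb1 inf_absorb2 sup_absorb1 sup_absorb2)
  next
    case (Join s t)
    show ?case
      using Join.IH(1)[OF Join.prems, of m] Join.IH(2)[OF Join.prems, of m]
        assms(2)[of "term_map F s m x" "term_map F t m x"]
      by (auto simp: inf_absorb1 inf_absorb2 sup_absorb1 sup_absorb2)
  qed (auto simp: assms(1))
  case (Mult s t)
  then show ?case
    by (metis mem UnE literals.simps(5))
qed auto

section \<open>Distributive l-pregroups act on chains\<close>

context distributive_lpregroup
begin

section \<open>Separation by prime filters\<close>

definition prime_filter :: "'a set \<Rightarrow> bool" where
  "prime_filter P \<longleftrightarrow> P \<subseteq> carrier A \<and>
    (\<forall>x\<in>P. \<forall>y\<in>carrier A. x \<^bold>\<le> y \<longrightarrow> y \<in> P) \<and> (\<forall>x\<in>P. \<forall>y\<in>P. x \<^bold>\<and> y \<in> P) \<and>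
    (\<forall>x\<in>carrier A. \<forall>y\<in>carrier A. x \<^bold>\<or> y \<in> P \<longrightarrow> x \<in> P \<or> y \<in> P)"

text \<open>The prime filter theorem by Zorn's lemma: a filter maximal among those containing
  \<open>s\<close> and avoiding \<open>t\<close> is prime by distributivity.\<close>

lemma prime_filter_separation:
  assumes s: "s \<in> carrier A" and t: "t \<in> carrier A" and st: "\<not> s \<^bold>\<le> t"
  shows "\<exists>P. prime_filter P \<and> s \<in> P \<and> t \<notin> P"
proof -
  define filt where "filt P \<longleftrightarrow> P \<subseteq> carrier A \<and> s \<in> P \<and> t \<notin> P \<and>
    (\<forall>x\<in>P. \<forall>y\<in>carrier A. x \<^bold>\<le> y \<longrightarrow> y \<in> P) \<and> (\<forall>x\<in>P. \<forall>y\<in>P. x \<^bold>\<and> y \<in> P)" for P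
  have filtD: "P \<subseteq> carrier A" "s \<in> P" "t \<notin> P"
    "\<And>x y. \<lbrakk>x \<in> P; y \<in> carrier A; x \<^bold>\<le> y\<rbrakk> \<Longrightarrow> y \<in> P" "\<And>x y. \<lbrakk>x \<in> P; y \<in> P\<rbrakk> \<Longrightarrow> x \<^bold>\<and> y \<in> P"
    if "filt P" for P
    using that by (auto simp: filt_def)
  have principal: "filt {x \<in> carrier A. s \<^bold>\<le> x}"
    unfolding filt_def
  proof (intro conjI ballI impI)
    fix x y assume "x \<in> {x \<in> carrier A. s \<^bold>\<le> x}" "y \<in> carrier A" "x \<^bold>\<le> y"
    then show "y \<in> {x \<in> carrier A. s \<^bold>\<le> x}"
      using le_trans[of s x y] s by simp
  qed (use s st in \<open>simp_all add: le_refl le_meetI meet_closed\<close>)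
  have "\<Union>C \<in> Collect filt" if C: "C \<noteq> {}" "subset.chain (Collect filt) C" for C
  proof -
    have filt: "filt P" if "P \<in> C" for P
      using C that by (auto simp: subset_chain_def)
    have "x \<^bold>\<and> y \<in> \<Union>C" if "P \<in> C" "Q \<in> C" "x \<in> P" "y \<in> Q" for x y P Q
    proof -
      have "P \<subseteq> Q \<or> Q \<subseteq> P"
        using C that by (auto simp: subset_chain_def)
      then show ?thesis
        using filtD(5)[OF filt[OF that(1)], of x y] filtD(5)[OF filt[OF that(2)], of x y] that by blast
    qed
    then have "filt (\<Union>C)"
      unfolding filt_def
    proof (intro conjI ballI impI)
      show "s \<in> \<Union>C"
        using C(1) filtD(2)[OF filt] by blast
      show "t \<notin> \<Union>C"
        using filtD(3)[OF filt] by blast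
      show "\<Union>C \<subseteq> carrier A"
        using filtD(1)[OF filt] by blast
      show "y \<in> \<Union>C" if "x \<in> \<Union>C" "y \<in> carrier A" "x \<^bold>\<le> y" for x y
        using that filtD(4)[OF filt] by blast
    qed blast
    then show ?thesis
      by simp
  qed
  then obtain P where "filt P" and max: "\<And>Q. \<lbrakk>filt Q; P \<subseteq> Q\<rbrakk> \<Longrightarrow> Q = P"
    using subset_Zorn_nonempty[of "Collect filt"] principal by auto
  note P = filtD[OF \<open>filt P\<close>]
  \<comment> \<open>By maximality, the filter generated by \<open>P\<close> and an outside element
    \<open>x\<close> must contain \<open>t\<close>.\<close>
  have extend: "\<exists>u\<in>P. u \<^bold>\<and> x \<^bold>\<le> t" if x: "x \<in> carrier A" "x \<notin> P" for x
  proof (rule ccontr)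
    assume no: "\<not> ?thesis"
    define Q where "Q = {y \<in> carrier A. \<exists>u\<in>P. u \<^bold>\<and> x \<^bold>\<le> y}"
    have PQ: "P \<subseteq> Q"
    proof
      fix u assume "u \<in> P"
      then show "u \<in> Q"
        using P(1) x meet_le1[of u x] by (auto simp: Q_def)
    qed
    have "filt Q"
      unfolding filt_def
    proof (intro conjI ballI impI)
      show "Q \<subseteq> carrier A" "t \<notin> Q"
        using no by (auto simp: Q_def)
      show "s \<in> Q"
        using PQ P(2) by blast
    next
      fix y z assume yz: "y \<in> Q" "z \<in> Q"
      then obtain u w where uw: "u \<in> P" "u \<^bold>\<and> x \<^bold>\<le> y" "w \<in> P" "w \<^bold>\<and> x \<^bold>\<le> z"
        and [simp]: "y \<in> carrier A" "z \<in> carrier A"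
        by (auto simp: Q_def)
      have [simp]: "u \<in> carrier A" "w \<in> carrier A" "x \<in> carrier A"
        using uw P(1) x by auto
      have "(u \<^bold>\<and> w) \<^bold>\<and> x \<^bold>\<le> u \<^bold>\<and> x" "(u \<^bold>\<and> w) \<^bold>\<and> x \<^bold>\<le> w \<^bold>\<and> x"
        by (intro meet_mono; simp add: meet_closed le_refl meet_le1 meet_le2)+
      then have "(u \<^bold>\<and> w) \<^bold>\<and> x \<^bold>\<le> y" "(u \<^bold>\<and> w) \<^bold>\<and> x \<^bold>\<le> z"
        using uw le_trans[of "(u \<^bold>\<and> w) \<^bold>\<and> x" "u \<^bold>\<and> x" y] le_trans[of "(u \<^bold>\<and> w) \<^bold>\<and> x" "w \<^bold>\<and> x" z]
        by (simp_all add: meet_closed)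
      then have "(u \<^bold>\<and> w) \<^bold>\<and> x \<^bold>\<le> y \<^bold>\<and> z"
        by (intro le_meetI) (simp_all add: meet_closed)
      moreover have "u \<^bold>\<and> w \<in> P"
        using uw P(5) by blast
      ultimately show "y \<^bold>\<and> z \<in> Q"
        by (auto simp: Q_def op_closed)
    next
      fix y z assume yz: "y \<in> Q" "z \<in> carrier A" "y \<^bold>\<le> z"
      then obtain u where "u \<in> P" "u \<^bold>\<and> x \<^bold>\<le> y" "y \<in> carrier A"
        by (auto simp: Q_def)
      then have "u \<^bold>\<and> x \<^bold>\<le> z"
        using le_trans[of "u \<^bold>\<and> x" y z] P(1) x yz by (auto simp: meet_closed)
      then show "z \<in> Q"
        using \<open>u \<in> P\<close> yz by (auto simp: Q_def)
    qed
    then have "Q = P"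
      using max PQ by blast
    moreover have "x \<in> Q"
      using P(2) meet_le2[OF s x(1)] x(1) by (auto simp: Q_def)
    ultimately show False
      using x by blast
  qed
  have "x \<in> P \<or> y \<in> P" if x: "x \<in> carrier A" and y: "y \<in> carrier A" and xy: "x \<^bold>\<or> y \<in> P" for x y
  proof (rule ccontr)
    assume "\<not> ?thesis"
    then obtain u w where uw: "u \<in> P" "u \<^bold>\<and> x \<^bold>\<le> t" "w \<in> P" "w \<^bold>\<and> y \<^bold>\<le> t"
      using extend[OF x] extend[OF y] by blast
    have [simp]: "u \<in> carrier A" "w \<in> carrier A" "x \<in> carrier A" "y \<in> carrier A" "t \<in> carrier A"
      using P(1) uw(1,3) x y t by blast+
    have "(u \<^bold>\<and> w) \<^bold>\<and> x \<^bold>\<le> u \<^bold>\<and> x" "(u \<^bold>\<and> w) \<^bold>\<and> y \<^bold>\<le> w \<^bold>\<and> y"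
      by (intro meet_mono; simp add: meet_closed le_refl meet_le1 meet_le2)+
    then have "(u \<^bold>\<and> w) \<^bold>\<and> x \<^bold>\<le> t" "(u \<^bold>\<and> w) \<^bold>\<and> y \<^bold>\<le> t"
      using uw le_trans[of "(u \<^bold>\<and> w) \<^bold>\<and> x" "u \<^bold>\<and> x" t] le_trans[of "(u \<^bold>\<and> w) \<^bold>\<and> y" "w \<^bold>\<and> y" t]
      by (simp_all add: meet_closed)
    then have "((u \<^bold>\<and> w) \<^bold>\<and> x) \<^bold>\<or> ((u \<^bold>\<and> w) \<^bold>\<and> y) \<^bold>\<le> t"
      by (intro join_leI) (simp_all add: op_closed)
    \<comment> \<open>Distributivity enters here: the join of the two meets becomes a meet of
      elements of \<open>P\<close>, which would force \<open>t\<close> into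
      \<open>P\<close>.\<close>
    then have "(u \<^bold>\<and> w) \<^bold>\<and> (x \<^bold>\<or> y) \<^bold>\<le> t"
      by (simp add: meet_join_distrib op_closed)
    moreover have "(u \<^bold>\<and> w) \<^bold>\<and> (x \<^bold>\<or> y) \<in> P"
      by (intro P(5) uw xy)
    ultimately show False
      using P(3) P(4)[OF _ t] by blast
  qed
  then have "prime_filter P"
    unfolding prime_filter_def
  proof (intro conjI ballI impI)
    show "y \<in> P" if "x \<in> P" "y \<in> carrier A" "x \<^bold>\<le> y" for x y
      by (rule P(4)[OF that])
    show "x \<^bold>\<and> y \<in> P" if "x \<in> P" "y \<in> P" for x y
      by (rule P(5)[OF that])
  qed (use P(1) in simp_all)
  then show ?thesis
    using P(2,3) by blast
qed

section \<open>The action on prime filters\<close>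

definition act :: "'a \<Rightarrow> 'a set \<Rightarrow> 'a set" where
  "act a X = {x \<in> carrier A. x \<otimes> a \<in> X}"

lemma prime_filter_subset: "prime_filter P \<Longrightarrow> P \<subseteq> carrier A"
  by (simp add: prime_filter_def)

lemma prime_filter_up: "\<lbrakk>prime_filter P; x \<in> P; y \<in> carrier A; x \<^bold>\<le> y\<rbrakk> \<Longrightarrow> y \<in> P"
  by (auto simp: prime_filter_def)

lemma prime_filter_meet_iff:
  assumes "prime_filter P" "x \<in> carrier A" "y \<in> carrier A"
  shows "x \<^bold>\<and> y \<in> P \<longleftrightarrow> x \<in> P \<and> y \<in> P"
proof -
  have "x \<^bold>\<and> y \<in> P \<Longrightarrow> x \<in> P" "x \<^bold>\<and> y \<in> P \<Longrightarrow> y \<in> P"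
    using prime_filter_up[OF assms(1), of "x \<^bold>\<and> y"] assms(2,3) by (simp_all add: meet_le1 meet_le2)
  moreover have "\<lbrakk>x \<in> P; y \<in> P\<rbrakk> \<Longrightarrow> x \<^bold>\<and> y \<in> P"
    using assms by (simp add: prime_filter_def)
  ultimately show ?thesis
    by blast
qed

lemma prime_filter_join_iff:
  assumes "prime_filter P" "x \<in> carrier A" "y \<in> carrier A"
  shows "x \<^bold>\<or> y \<in> P \<longleftrightarrow> x \<in> P \<or> y \<in> P"
proof -
  have "x \<in> P \<Longrightarrow> x \<^bold>\<or> y \<in> P" "y \<in> P \<Longrightarrow> x \<^bold>\<or> y \<in> P"
    using prime_filter_up[OF assms(1), of _ "x \<^bold>\<or> y"] assms(2,3)
    by (simp_all add: join_ge1 join_ge2 join_closed)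
  moreover have "x \<^bold>\<or> y \<in> P \<Longrightarrow> x \<in> P \<or> y \<in> P"
    using assms by (simp add: prime_filter_def)
  ultimately show ?thesis
    by blast
qed

text \<open>Right multiplication is a lattice homomorphism, so it pulls prime filters back to prime
  filters. As \<open>prime_filter\<close> admits the empty set and the whole carrier, nothing about
  properness arises.\<close>

lemma prime_filter_act:
  assumes P: "prime_filter P" and a [simp]: "a \<in> carrier A"
  shows "prime_filter (act a P)"
  unfolding prime_filter_def
proof (intro conjI ballI impI)
  fix x y assume "x \<in> act a P" "y \<in> carrier A" "x \<^bold>\<le> y"
  then show "y \<in> act a P"
    using prime_filter_up[OF P, of "x \<otimes> a" "y \<otimes> a"] mult_mono_left[of x y a] by (simp add: act_def)
qed (simp_all add: act_def meet_mult_distrib join_mult_distrib prime_filter_meet_iff[OF P]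
    prime_filter_join_iff[OF P] meet_closed subset_iff)

lemma act_one: "prime_filter P \<Longrightarrow> act \<one> P = P"
  using prime_filter_subset[of P] by (auto simp: act_def subset_iff)

text \<open>Taking preimages under right multiplication turns the right action of the algebra on
  itself into a left action.\<close>

lemma act_mult: "\<lbrakk>a \<in> carrier A; b \<in> carrier A\<rbrakk> \<Longrightarrow> act (a \<otimes> b) P = act a (act b P)"
  by (auto simp: act_def m_assoc)

lemma act_meet: "\<lbrakk>prime_filter P; a \<in> carrier A; b \<in> carrier A\<rbrakk> \<Longrightarrow> act (a \<^bold>\<and> b) P = act a P \<inter> act b P"
  by (auto simp: act_def mult_meet_distrib prime_filter_meet_iff)

text \<open>Primeness is what turns the join into a union.\<close>

lemma act_join: "\<lbrakk>prime_filter P; a \<in> carrier A; b \<in> carrier A\<rbrakk> \<Longrightarrow> act (a \<^bold>\<or> b) P = act a P \<union> act b P"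
  by (auto simp: act_def mult_join_distrib prime_filter_join_iff)

lemma act_adjoint:
  assumes "prime_filter X" "prime_filter Y" and a [simp]: "a \<in> carrier A"
  shows "act a X \<subseteq> Y \<longleftrightarrow> X \<subseteq> act (\<r> a) Y"
proof
  assume *: "act a X \<subseteq> Y"
  show "X \<subseteq> act (\<r> a) Y"
  proof
    fix x assume x: "x \<in> X"
    then have [simp]: "x \<in> carrier A"
      using assms prime_filter_subset by blast
    have "x \<^bold>\<le> (x \<otimes> \<r> a) \<otimes> a"
      by (rule mult_le_iff_right[THEN iffD1]) (simp_all add: le_refl op_closed)
    then have "x \<otimes> \<r> a \<in> act a X"
      using prime_filter_up[OF assms(1) x] by (simp add: act_def op_closed)
    then show "x \<in> act (\<r> a) Y"
      using * by (auto simp: act_def)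
  qed
next
  assume *: "X \<subseteq> act (\<r> a) Y"
  show "act a X \<subseteq> Y"
  proof
    fix x assume "x \<in> act a X"
    then have [simp]: "x \<in> carrier A" and "x \<otimes> a \<in> act (\<r> a) Y"
      using * by (auto simp: act_def)
    then have "(x \<otimes> a) \<otimes> \<r> a \<in> Y"
      by (simp add: act_def)
    moreover have "(x \<otimes> a) \<otimes> \<r> a \<^bold>\<le> x"
      by (rule mult_le_iff_right[THEN iffD2]) (simp_all add: le_refl op_closed)
    ultimately show "x \<in> Y"
      using prime_filter_up[OF assms(2)] by simp
  qed
qed

text \<open>A union of two filters is a filter only if they are comparable.\<close>

lemma act_total:
  assumes P: "prime_filter P" and [simp]: "a \<in> carrier A" "b \<in> carrier A"
  shows "act a P \<subseteq> act b P \<or> act b P \<subseteq> act a P"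
proof (rule ccontr)
  assume "\<not> ?thesis"
  then obtain x y where xy: "x \<in> act a P" "x \<notin> act b P" "y \<in> act b P" "y \<notin> act a P"
    by blast
  then have [simp]: "x \<in> carrier A" "y \<in> carrier A"
    by (simp_all add: act_def)
  have "x \<in> act (a \<^bold>\<or> b) P" "y \<in> act (a \<^bold>\<or> b) P"
    using xy by (simp_all add: act_join P)
  then have "x \<^bold>\<and> y \<in> act (a \<^bold>\<or> b) P"
    using prime_filter_act[OF P, of "a \<^bold>\<or> b"] by (simp add: prime_filter_meet_iff join_closed)
  then have "x \<^bold>\<and> y \<in> act a P \<or> x \<^bold>\<and> y \<in> act b P"
    by (simp add: act_join P)
  then show False
    using xy prime_filter_act[OF P] by (simp add: prime_filter_meet_iff)
qed

text \<open>The unit belongs to \<open>act s P\<close> exactly when \<open>s\<close> belongs to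
  \<open>P\<close>, so separating the elements separates their actions.\<close>

lemma prime_filter_distinguishes:
  assumes [simp]: "s \<in> carrier A" "t \<in> carrier A" and "s \<noteq> t"
  shows "\<exists>P. prime_filter P \<and> act s P \<noteq> act t P"
proof -
  have "\<not> s \<^bold>\<le> t \<or> \<not> t \<^bold>\<le> s"
    using assms le_antisym by blast
  then obtain P where "prime_filter P" "(s \<in> P) \<noteq> (t \<in> P)"
    using prime_filter_separation[of s t] prime_filter_separation[of t s] by auto
  moreover from this have "(\<one> \<in> act s P) \<noteq> (\<one> \<in> act t P)"
    by (simp add: act_def)
  ultimately show ?thesis
    by blast
qed

text \<open>The two sides act differently on some prime filter; its orbit is a chain, and the
  finitely many literals evaluated there are realized by periodic maps. The bound is only quadratic
  in the length.\<close>

lemma fails_in_Fn_Z: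
  assumes fails: "fails_in \<epsilon> A" and "even n" and N: "N = eq_length \<epsilon>"
    and n: "(4 * N + 1) * (N + 2) + 2 * N + 3 \<le> n"
  shows "fails_in \<epsilon> (Fn_Z n)"
proof -
  obtain v where v: "\<And>i. v i \<in> carrier A"
    and neq: "eval_term A v (fst \<epsilon>) \<noteq> eval_term A v (snd \<epsilon>)"
    using fails by (auto simp: fails_in_def)
  obtain P where P: "prime_filter P"
    and act_neq: "act (eval_term A v (fst \<epsilon>)) P \<noteq> act (eval_term A v (snd \<epsilon>)) P"
    using prime_filter_distinguishes[OF eval_term_closed eval_term_closed neq] v by blast
  \<comment> \<open>A single orbit, because inclusion is total only between images of the same
    filter.\<close>
  define Om where "Om = (\<lambda>a. act a P) ` carrier A"
  define F where "F = (\<lambda>i m. act (res_pow A m (v i)))"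
  have Om: "prime_filter X" if "X \<in> Om" for X
    using that P by (auto simp: Om_def prime_filter_act)
  have act_Om: "act a X \<in> Om" if "a \<in> carrier A" "X \<in> Om" for a X
    using that by (auto simp: Om_def simp flip: act_mult)
  have "P \<in> Om"
    unfolding Om_def using act_one[OF P] by (metis image_eqI one_closed)
  have total: "X \<subseteq> Y \<or> Y \<subseteq> X" if "X \<in> Om" "Y \<in> Om" for X Y
    using that act_total[OF P] by (auto simp: Om_def)
  interpret residuated_family Om F
  proof
    show "F i m X \<in> Om" if "X \<in> Om" for X i m
      by (simp add: F_def act_Om that res_pow_closed v)
    show "F i m X \<subseteq> Y \<longleftrightarrow> X \<subseteq> F i (m + 1) Y" if "X \<in> Om" "Y \<in> Om" for X Y i m
      using act_adjoint[OF Om[OF that(1)] Om[OF that(2)] res_pow_closed[OF v[of i], of m]]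
      by (simp add: F_def r_res_pow v)
  qed (use total in blast)
  have eval_F: "act (eval_term A v t) P = term_map F t 0 P" for t
    using action_eval_term[of Om act v P 0 t] \<open>P \<in> Om\<close> v
    by (simp add: F_def act_Om act_one act_mult act_meet act_join Om)
  \<comment> \<open>Both sides together have at most \<open>N\<close> literals, with orders of
    absolute value at most \<open>N\<close>, so \<open>N\<close> serves for both bounds.\<close>
  define S where "S = literals F (fst \<epsilon>) 0 P \<union> literals F (snd \<epsilon>) 0 P"
  obtain D and \<phi> :: "'a set \<Rightarrow> int" and g where "P \<in> D" "D \<subseteq> Om"
    and \<phi>: "\<And>X Y. \<lbrakk>X \<in> D; Y \<in> D\<rbrakk> \<Longrightarrow> X \<subseteq> Y \<longleftrightarrow> \<phi> X \<le> \<phi> Y"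
    and g: "\<And>i. periodic_mono (int n) (g i)"
    and S: "\<And>i m X. (i, m, X) \<in> S \<Longrightarrow> F i m X \<in> D \<and> \<phi> (F i m X) = res_pow F_Z m (g i) (\<phi> X)"
  proof (rule realize_literals[of S N P N "int n"])
    show "finite S"
      by (simp add: S_def finite_literals)
    show "card S \<le> N"
      using card_Un_le[of "literals F (fst \<epsilon>) 0 P" "literals F (snd \<epsilon>) 0 P"]
        card_literals[of F "fst \<epsilon>" 0 P] card_literals[of F "snd \<epsilon>" 0 P]
      by (simp add: S_def N eq_length_def)
    show "X \<in> Om \<and> \<bar>m\<bar> \<le> int N" if "(i, m, X) \<in> S" for i m X
      using that literals_mem[OF F_closed total \<open>P \<in> Om\<close>]
        order_literals[of i m X F "fst \<epsilon>" 0 P] order_literals[of i m X F "snd \<epsilon>" 0 P]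
      by (auto simp: S_def N eq_length_def)
    show "int ((4 * N + 1) * (N + 2) + 2 * N + 3) \<le> int n"
      using n by linarith
  qed (use \<open>P \<in> Om\<close> in auto)
  have D_total: "X \<subseteq> Y \<or> Y \<subseteq> X" if "X \<in> D" "Y \<in> D" for X Y
    using that total \<open>D \<subseteq> Om\<close> by blast
  have mem: "term_map F t 0 P \<in> D"
    and eval_g: "\<phi> (term_map F t 0 P) = eval_term (Fn_Z n) g t (\<phi> P)"
    if t: "t \<in> {fst \<epsilon>, snd \<epsilon>}" for t
  proof -
    have lit: "F i k X \<in> D \<and> \<phi> (F i k X) = res_pow F_Z k (g i) (\<phi> X)"
      if "(i, k, X) \<in> literals F t 0 P" for i k X
      using S that t by (auto simp: S_def)
    show "term_map F t 0 P \<in> D"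
      using term_map_mem[OF D_total _ \<open>P \<in> D\<close>] lit by blast
    have "g i \<in> carrier F_Z" for i
      using periodic_mono_unbounded[OF g] n by (simp add: carrier_F_Z)
    \<comment> \<open>Application of maps is an action of \<open>F_Z\<close> on the integers, so the
      same evaluation lemma applies.\<close>
    then have "term_map (\<lambda>i m. res_pow F_Z m (g i)) t 0 x = eval_term F_Z g t x" for x
      using F_Z.action_eval_term[of UNIV "\<lambda>f. f" g x 0 t] by (simp add: inf_min sup_max)
    moreover have "\<phi> (term_map F t 0 P) = term_map (\<lambda>i m. res_pow F_Z m (g i)) t 0 (\<phi> P)"
      using \<phi> lit \<open>P \<in> D\<close> D_total by (intro term_map_transfer[of D]) blast+
    ultimately show "\<phi> (term_map F t 0 P) = eval_term (Fn_Z n) g t (\<phi> P)"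
      by (simp add: eval_term_Fn_Z)
  qed
  \<comment> \<open>Since \<open>\<phi>\<close> reflects inclusion, it is injective on
    \<open>D\<close>.\<close>
  have "\<phi> (term_map F (fst \<epsilon>) 0 P) \<noteq> \<phi> (term_map F (snd \<epsilon>) 0 P)"
    using act_neq \<phi> mem unfolding eval_F by (metis insertI1 insertI2 order_refl subset_antisym)
  then have "eval_term (Fn_Z n) g (fst \<epsilon>) \<noteq> eval_term (Fn_Z n) g (snd \<epsilon>)"
    using eval_g by auto
  moreover have "g i \<in> carrier (Fn_Z n)" for i
    using periodic_mono_in_Fn_Z[OF g] n \<open>even n\<close> by simp
  ultimately show ?thesis
    by (auto simp: fails_in_def)
qed

end

section \<open>Failure in a countable subalgebra\<close>

instance lp_term :: countable
  by countable_datatype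

text \<open>The subalgebra generated by the values of the variables is countable, so it embeds into every
  infinite type.\<close>

lemma fails_in_DLP_transfer:
  fixes A :: "('b, 'm) lpregroup_scheme"
  assumes "distributive_lpregroup A" "fails_in \<epsilon> A" "infinite (UNIV :: 'a set)"
  shows "fails_in_DLP TYPE('a) \<epsilon>"
proof -
  interpret A: distributive_lpregroup A by fact
  obtain v where v: "\<And>i. v i \<in> carrier A"
    and neq: "eval_term A v (fst \<epsilon>) \<noteq> eval_term A v (snd \<epsilon>)"
    using assms(2) by (auto simp: fails_in_def)
  \<comment> \<open>The generated subalgebra: values of terms are closed under all operations, and
    there are only countably many terms.\<close>
  define S where "S = range (eval_term A v)"
  have S_iff: "x \<in> S \<longleftrightarrow> (\<exists>t. x = eval_term A v t)" for x
    by (auto simp: S_def)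
  have S: "x \<otimes>\<^bsub>A\<^esub> y \<in> S" "x \<^bold>\<and>\<^bsub>A\<^esub> y \<in> S" "x \<^bold>\<or>\<^bsub>A\<^esub> y \<in> S" if "x \<in> S" "y \<in> S" for x y
    using that unfolding S_iff by (metis eval_term.simps(5), metis eval_term.simps(3), metis eval_term.simps(4))
  have S': "\<l>\<^bsub>A\<^esub> x \<in> S" "\<r>\<^bsub>A\<^esub> x \<in> S" if "x \<in> S" for x
    using that unfolding S_iff by (metis eval_term.simps(6), metis eval_term.simps(7))
  have one_S: "\<one>\<^bsub>A\<^esub> \<in> S"
    unfolding S_iff by (metis eval_term.simps(2))
  have sub: "x \<in> carrier A" if "x \<in> S" for x
    using that A.eval_term_closed v by (auto simp: S_def)
  obtain f :: "nat \<Rightarrow> 'a" where "inj f"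
    using infinite_countable_subset[OF assms(3)] by blast
  \<comment> \<open>Choose a term for each element, number it, and send the number into the target
    type.\<close>
  define h where "h x = f (to_nat (inv_into UNIV (eval_term A v) x))" for x
  have h: "inj_on h S"
  proof (rule inj_onI)
    fix x y assume xy: "x \<in> S" "y \<in> S" "h x = h y"
    then have "inv_into UNIV (eval_term A v) x = inv_into UNIV (eval_term A v) y"
      using inj_eq[OF \<open>inj f\<close>] by (simp add: h_def)
    then show "x = y"
      using xy by (auto simp: S_def intro: inv_into_injective)
  qed
  define d where "d = inv_into S h"
  have dh [simp]: "d (h x) = x" if "x \<in> S" for x
    using h that by (simp add: d_def)
  have h_eq [simp]: "h x = h y \<longleftrightarrow> x = y" if "x \<in> S" "y \<in> S" for x y
    using h that by (auto simp: inj_on_def)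
  define B :: "'a lpregroup" where "B = \<lparr>carrier = h ` S,
    mult = (\<lambda>x y. h (d x \<otimes>\<^bsub>A\<^esub> d y)), one = h \<one>\<^bsub>A\<^esub>,
    lp_meet = (\<lambda>x y. h (d x \<^bold>\<and>\<^bsub>A\<^esub> d y)), lp_join = (\<lambda>x y. h (d x \<^bold>\<or>\<^bsub>A\<^esub> d y)),
    lp_l = (\<lambda>x. h (\<l>\<^bsub>A\<^esub> (d x))), lp_r = (\<lambda>x. h (\<r>\<^bsub>A\<^esub> (d x)))\<rparr>"
  have B [simp]: "carrier B = h ` S" "one B = h \<one>\<^bsub>A\<^esub>"
    "\<And>x y. \<lbrakk>x \<in> S; y \<in> S\<rbrakk> \<Longrightarrow> h x \<otimes>\<^bsub>B\<^esub> h y = h (x \<otimes>\<^bsub>A\<^esub> y)"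
    "\<And>x y. \<lbrakk>x \<in> S; y \<in> S\<rbrakk> \<Longrightarrow> h x \<^bold>\<and>\<^bsub>B\<^esub> h y = h (x \<^bold>\<and>\<^bsub>A\<^esub> y)"
    "\<And>x y. \<lbrakk>x \<in> S; y \<in> S\<rbrakk> \<Longrightarrow> h x \<^bold>\<or>\<^bsub>B\<^esub> h y = h (x \<^bold>\<or>\<^bsub>A\<^esub> y)"
    "\<And>x. x \<in> S \<Longrightarrow> \<l>\<^bsub>B\<^esub> (h x) = h (\<l>\<^bsub>A\<^esub> x)"
    "\<And>x. x \<in> S \<Longrightarrow> \<r>\<^bsub>B\<^esub> (h x) = h (\<r>\<^bsub>A\<^esub> x)"
    by (simp_all add: B_def)
  have le [simp]: "h x \<^bold>\<le>\<^bsub>B\<^esub> h y \<longleftrightarrow> x \<^bold>\<le>\<^bsub>A\<^esub> y" if "x \<in> S" "y \<in> S" for x y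
    using that S(2)[OF that] by (simp add: lp_le_def)
  note [simp] = S S' one_S sub
  have "distributive_lpregroup B"
    by (unfold_locales; (elim imageE[where f = h and A = S, folded B(1)])?)
      (auto simp: A.m_assoc A.meet_assoc A.join_assoc A.meet_join_absorb A.join_meet_absorb
      A.meet_join_distrib A.mult_mono_left A.mult_mono_right A.l_mult_le_one A.one_le_mult_l
      A.mult_r_le_one A.one_le_r_mult intro: A.meet_commute A.join_commute)
  moreover have "v i \<in> S" for i
    unfolding S_iff by (metis eval_term.simps(1))
  moreover have "eval_term B (\<lambda>i. h (v i)) t = h (eval_term A v t)" for t
  proof -
    have "eval_term A v t \<in> S" for t
      by (simp add: S_def)
    then show ?thesis
      using \<open>\<And>i. v i \<in> S\<close> by (induction t) simp_all
  qed
  ultimately show ?thesis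
    using neq unfolding fails_in_DLP_def fails_in_def
    by (intro exI[of _ B] conjI exI[of _ "\<lambda>i. h (v i)"]) (auto simp: S_def)
qed

theorem theorem3p8:
  fixes \<epsilon> :: lp_equation
  assumes "infinite (UNIV :: 'a set)"
  shows "fails_in_DLP TYPE('a) \<epsilon> \<longleftrightarrow>
    fails_in \<epsilon> (Fn_Z (2 ^ eq_length \<epsilon> * eq_length \<epsilon> ^ 4))"
proof
  define N where "N = eq_length \<epsilon>"
  have "1 \<le> term_length t" for t
    by (induction t) auto
  then have "2 \<le> N"
    unfolding N_def eq_length_def by (metis add_mono one_add_one)
  assume "fails_in_DLP TYPE('a) \<epsilon>"
  then obtain A :: "'a lpregroup" where "distributive_lpregroup A" "fails_in \<epsilon> A"
    by (auto simp: fails_in_DLP_def)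
  then interpret A: distributive_lpregroup A by simp
  \<comment> \<open>The quadratic bound is below \<open>16 * N\<^sup>2\<close>; then
    \<open>2 ^ N\<close> and \<open>N\<^sup>2\<close> each absorb a factor 4, since \<open>N\<close>
    is at least 2.\<close>
  have "(4 * N + 1) * (N + 2) + 2 * N + 3 \<le> 4 * (4 * N\<^sup>2)"
  proof -
    have "2 * N \<le> N\<^sup>2"
      using \<open>2 \<le> N\<close> by (simp add: power2_eq_square)
    moreover have "(4 * N + 1) * (N + 2) + 2 * N + 3 = 4 * N\<^sup>2 + 11 * N + 5"
      by (simp add: power2_eq_square algebra_simps)
    ultimately show ?thesis
      using \<open>2 \<le> N\<close> by linarith
  qed
  also have "\<dots> \<le> 2 ^ N * N ^ 4"
  proof (rule mult_mono)
    show "4 \<le> (2::nat) ^ N"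
      using power_increasing[OF \<open>2 \<le> N\<close>, of "2::nat"] by simp
    have "2 ^ 2 * N\<^sup>2 \<le> N\<^sup>2 * N\<^sup>2"
      using power_mono[OF \<open>2 \<le> N\<close>, of 2] by (intro mult_mono) auto
    then show "4 * N\<^sup>2 \<le> N ^ 4"
      by (simp flip: power_add)
  qed auto
  \<comment> \<open>The factor \<open>2 ^ N\<close> also makes the bound even.\<close>
  finally show "fails_in \<epsilon> (Fn_Z (2 ^ eq_length \<epsilon> * eq_length \<epsilon> ^ 4))"
    using \<open>2 \<le> N\<close> \<open>fails_in \<epsilon> A\<close> by (intro A.fails_in_Fn_Z[OF _ _ N_def]) (auto simp: N_def)
next
  assume "fails_in \<epsilon> (Fn_Z (2 ^ eq_length \<epsilon> * eq_length \<epsilon> ^ 4))"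
  \<comment> \<open>The algebra of integer maps lives on another type, so its failing equation is
    carried over through a countable subalgebra.\<close>
  then show "fails_in_DLP TYPE('a) \<epsilon>"
    using fails_in_DLP_transfer[OF distributive_lpregroup_Fn_Z] assms by blast
qed

end
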